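(* Let $q$ be a prime power with $q>9$ if $q$ is odd and $q>2$ if $q$ is even. Let $U$ be an intersecting family of polynomials over $\mathbb{F}_q$ of degree at most $2$. If \[|U|>q^2-\frac{q\sqrt{q}}{4}+\frac{cq}{8}+\frac{\sqrt{q}}{8},\] where $c=1$ if $q$ is even and $c=3$ if $q$ is odd, then the graphs of the polynomials in $U$ share a common point, i.e. there exist $\alpha,\beta\in\mathbb{F}_q$ with $g(\alpha)=\beta$ for all $g\in U$.
   Context: For a function $f\colon\mathbb{F}_q\to\mathbb{F}_q$ its graph is $U_f=\{(x,f(x)) : x\in\mathbb{F}_q\}\subseteq\mathbb{F}_q^2$. A set $U$ of polynomials over $\mathbb{F}_q$ is intersecting if for any two $f_1,f_2\in U$ the graphs of $f_1$ and $f_2$ share at least one point. *)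

theory Defs
  imports "HOL-Computational_Algebra.Polynomial" Complex_Main
begin

definition graph_of :: "'a::comm_semiring_0 poly \<Rightarrow> ('a \<times> 'a) set" where
  "graph_of f = {(x, poly f x) | x. True}"

definition intersecting :: "'a::comm_semiring_0 poly set \<Rightarrow> bool" where
  "intersecting U \<longleftrightarrow> (\<forall>f1\<in>U. \<forall>f2\<in>U. graph_of f1 \<inter> graph_of f2 \<noteq> {})"

end

theory Submission
  imports Defs "HOL-Analysis.Convex" "HOL-Library.Cardinality"
begin

text \<open>Write \<open>q\<close> for the order of the field, \<open>u = |U|\<close>, and \<open>n\<^sub>P\<close> for the number of members of \<open>U\<close> through
  a point \<open>P\<close>. Two distinct members meet in one point (tangent pair) or in two points. Tangent
  pairs are rare, so the sum of \<open>n\<^sub>P\<^sup>2\<close> over all points is close to \<open>2u\<^sup>2\<close> and some point has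
  \<open>n\<^sub>P\<close> at least about \<open>2u/q\<close>.

  Fix such a \<open>P\<close>. A member of \<open>U\<close> that avoids \<open>P\<close> meets all \<open>n\<^sub>P\<close> members through \<open>P\<close>, most of them twice,
  whereas an average polynomial avoiding \<open>P\<close> meets each of them only about once. The variance of the number of
  intersections, computed over all polynomials of degree at most 2 avoiding \<open>P\<close>, then gives
  roughly \<open>n\<^sub>P (u - n\<^sub>P) \<le> q\<^sup>3\<close>, which contradicts \<open>n\<^sub>P \<ge> 2u/q\<close> unless \<open>n\<^sub>P\<close> is so large that no polynomial avoiding
  \<open>P\<close> can meet all members through \<open>P\<close>.

  In even characteristic a tangent pair shares one of its first two coefficients. In odd
  characteristic it shares the leading coefficient or differs by a multiple of some \<open>(x - r)\<^sup>2\<close>;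
  pairs of the second kind are counted by double counting over all linear functionals on the
  coefficient space. For \<open>q = 4\<close> the variance is replaced by a direct count of the
  members through \<open>P\<close> that meet a given polynomial twice.\<close>

subsection \<open>Quadratic polynomials as an orthogonal array\<close>

text \<open>Coefficient triples make the polynomials of degree at most 2 a finite type, so that sums
  over all of them are sums over \<open>UNIV\<close>.\<close>

fun ev :: "'a::field \<times> 'a \<times> 'a \<Rightarrow> 'a \<Rightarrow> 'a" where
  "ev (a, b, c) x = a * x\<^sup>2 + b * x + c"

definition meets :: "'a::{finite,field} \<times> 'a \<times> 'a \<Rightarrow> 'a \<times> 'a \<times> 'a \<Rightarrow> nat" where
  "meets f g = card {x. ev f x = ev g x}"

lemma ev_diff: "ev (f - g) x = ev f x - ev g x"
  by (cases f; cases g) (simp add: algebra_simps)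

lemma quadratic_three_roots:
  fixes a b c :: "'a::field"
  assumes "ev (a, b, c) x = 0" "ev (a, b, c) y = 0" "ev (a, b, c) z = 0"
    and "x \<noteq> y" "x \<noteq> z" "y \<noteq> z"
  shows "a = 0 \<and> b = 0 \<and> c = 0"
proof -
  have "(x - y) * (a * (x + y) + b) = 0" "(x - z) * (a * (x + z) + b) = 0"
    using assms(1-3) by (simp_all add: power2_eq_square) algebra+
  then have *: "a * (x + y) + b = 0" "a * (x + z) + b = 0"
    using assms(4,5) by simp_all
  then have "a * (y - z) = 0" by algebra
  then have "a = 0" using assms(6) by simp
  then show ?thesis using * assms(1) by simp
qed

text \<open>Three values determine a quadratic, and coefficient triples and value triples form the
  same finite type. This is the orthogonal array property: the values at three nodes are independent
  and uniform.\<close>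

lemma bij_interpolation:
  fixes x0 x1 x2 :: "'a::{finite,field}"
  assumes "x0 \<noteq> x1" "x0 \<noteq> x2" "x1 \<noteq> x2"
  shows "bij (\<lambda>f. (ev f x0, ev f x1, ev f x2))"
proof -
  have "inj (\<lambda>f. (ev f x0, ev f x1, ev f x2))"
  proof (rule injI)
    fix f g assume eq: "(ev f x0, ev f x1, ev f x2) = (ev g x0, ev g x1, ev g x2)"
    obtain a b c where abc: "f - g = (a, b, c)" by (metis prod_cases3)
    have "ev (f - g) x0 = 0" "ev (f - g) x1 = 0" "ev (f - g) x2 = 0"
      using eq by (simp_all add: ev_diff)
    from quadratic_three_roots[OF this[unfolded abc] assms] show "f = g"
      using abc by (simp add: zero_prod_def[symmetric])
  qed
  then show ?thesis by (simp add: bij_def finite_UNIV_inj_surj)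
qed

lemma sum_interpolation:
  fixes x0 x1 x2 :: "'a::{finite,field}" and F :: "'a \<Rightarrow> 'a \<Rightarrow> 'a \<Rightarrow> real"
  assumes "x0 \<noteq> x1" "x0 \<noteq> x2" "x1 \<noteq> x2"
  shows "(\<Sum>f\<in>UNIV. F (ev f x0) (ev f x1) (ev f x2)) =
         (\<Sum>z\<in>UNIV. \<Sum>y\<in>UNIV. \<Sum>y'\<in>UNIV. F z y y')"
proof -
  have "(\<Sum>f\<in>UNIV. F (ev f x0) (ev f x1) (ev f x2)) =
        (\<Sum>(z, y, y')\<in>UNIV. F z y y')"
    by (rule sum.reindex_bij_betw[OF bij_interpolation[OF assms],
          where g = "\<lambda>(z, y, y'). F z y y'", simplified])
  then show ?thesis
    by (simp add: UNIV_Times_UNIV[symmetric] sum.cartesian_product del: UNIV_Times_UNIV)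
qed

lemma meets_le_2:
  fixes f g :: "'a::{finite,field} \<times> 'a \<times> 'a"
  assumes "f \<noteq> g"
  shows "meets f g \<le> 2"
proof (rule ccontr)
  assume "\<not> meets f g \<le> 2"
  then have "3 \<le> card {x. ev f x = ev g x}" by (simp add: meets_def)
  then obtain T where T: "T \<subseteq> {x. ev f x = ev g x}" "card T = 3"
    by (meson obtain_subset_with_card_n)
  then obtain x y z where "T = {x, y, z}" "x \<noteq> y" "x \<noteq> z" "y \<noteq> z"
    by (auto simp: card_Suc_eq numeral_3_eq_3)
  moreover from this T have "ev (f - g) x = 0" "ev (f - g) y = 0" "ev (f - g) z = 0"
    by (auto simp: ev_diff)
  moreover obtain a b c where abc: "f - g = (a, b, c)" by (metis prod_cases3)
  ultimately have "f - g = 0"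
    using quadratic_three_roots[of a b c x y z] by (simp add: zero_prod_def)
  with assms show False by simp
qed

lemma meets_self [simp]: "meets f f = CARD('a)"
  for f :: "'a::{finite,field} \<times> 'a \<times> 'a"
  by (simp add: meets_def)

lemma meets_commute: "meets f g = meets g f"
  by (simp add: meets_def eq_commute)

lemma meets_eq_sum: "real (meets f g) = (\<Sum>x\<in>UNIV. of_bool (ev f x = ev g x))"
  by (simp add: meets_def)

text \<open>The difference is \<open>a (x - r)\<^sup>2\<close>; this form covers characteristic 2, where it forces
  the linear coefficients to agree.\<close>

lemma tangent_cases:
  fixes a b c a' b' c' :: "'a::{finite,field}"
  assumes "meets (a, b, c) (a', b', c') = 1" "a \<noteq> a'"
  obtains r where "b - b' = (a - a') * (- 2 * r)" "c - c' = (a - a') * r\<^sup>2"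
proof -
  define S where "S = {x. ev (a, b, c) x = ev (a', b', c') x}"
  have "card S = 1" using assms by (simp add: meets_def S_def)
  then obtain r where S: "S = {r}" by (auto simp: card_1_singleton_iff)
  define A B C where "A = a - a'" and "B = b - b'" and "C = c - c'"
  have mem: "x \<in> S \<longleftrightarrow> A * x\<^sup>2 + B * x + C = 0" for x
    by (auto simp: S_def A_def B_def C_def algebra_simps)
  have A: "A \<noteq> 0" using assms(2) by (simp add: A_def)
  have r: "A * r\<^sup>2 + B * r + C = 0" using mem S by blast
  \<comment> \<open>By Vieta \<open>- B / A - r\<close> is the other root; since \<open>r\<close> is
    the only one, the two coincide.\<close>
  have "A * (- B / A - r)\<^sup>2 + B * (- B / A - r) + C = A * r\<^sup>2 + B * r + C"
    using A by (simp add: field_simps power2_eq_square)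
  then have "- B / A - r \<in> S" using r mem by simp
  then have "- B / A - r = r" using S by simp
  then have "- B = A * (2 * r)" using A by (simp add: field_simps)
  then have B: "B = A * (- 2 * r)" by (metis minus_minus minus_mult_left mult_minus_right)
  moreover have "C = A * r\<^sup>2" using r unfolding B by (simp add: power2_eq_square algebra_simps)
  ultimately show thesis using that[of r] unfolding A_def B_def C_def by blast
qed

text \<open>The difference is linear, vanishes at \<open>x\<close> and is not zero, so its slope is
  nonzero.\<close>

lemma meets_eq_1_same_leading_coeff:
  assumes "ev f x = ev g x" "f \<noteq> g" "fst f = fst g"
  shows "meets f g = 1"
proof -
  obtain a b c where f: "f = (a, b, c)" by (metis prod_cases3)
  obtain a' b' c' where g: "g = (a', b', c')" by (metis prod_cases3)
  have a: "a' = a" using assms f g by simp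
  have "b \<noteq> b'" using assms f g a by auto
  then have "y = x" if "ev f y = ev g y" for y
  proof -
    have "b * x + c = b' * x + c'" "b * y + c = b' * y + c'"
      using assms(1) that f g a by (simp_all add: algebra_simps)
    then have "(b - b') * (y - x) = 0" by algebra
    then show ?thesis using \<open>b \<noteq> b'\<close> by simp
  qed
  then have "{x. ev f x = ev g x} = {x}" using assms(1) by blast
  then show ?thesis by (simp add: meets_def)
qed

text \<open>\<open>2 * a * x + b\<close> is the derivative at \<open>x\<close>. Equal values and
  derivatives there turn the difference at \<open>y\<close> into
  \<open>(a - a') * (y - x)\<^sup>2\<close>, in every characteristic.\<close>

lemma meets_eq_1_same_slope:
  fixes a b c a' b' c' x :: "'a::{finite,field}"
  assumes "ev (a, b, c) x = ev (a', b', c') x" "(a, b, c) \<noteq> (a', b', c')"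
    and "2 * a * x + b = 2 * a' * x + b'"
  shows "meets (a, b, c) (a', b', c') = 1"
proof -
  have ne: "a \<noteq> a'" using assms by auto
  have "y = x" if "ev (a, b, c) y = ev (a', b', c') y" for y
  proof -
    have "(a - a') * (y - x)\<^sup>2 = 0"
      using assms(1,3) that by (simp add: power2_eq_square) algebra
    then show ?thesis using ne by simp
  qed
  then have "{x. ev (a, b, c) x = ev (a', b', c') x} = {x}" using assms(1) by blast
  then show ?thesis by (simp add: meets_def)
qed

section \<open>Incidences with points and their second moment\<close>

definition cnt :: "('a::{finite,field} \<times> 'a \<times> 'a) set \<Rightarrow> 'a \<Rightarrow> 'a \<Rightarrow> real" where
  "cnt A x y = (\<Sum>f\<in>A. of_bool (ev f x = y))"

lemma card_Compl_singleton: "real (card (-{x :: 'a::finite})) = real CARD('a) - 1"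
  by (simp add: Compl_eq_Diff_UNIV card_Diff_singleton of_nat_diff Suc_leI)

lemma sum_Collect_of_bool:
  fixes F :: "'b::finite \<Rightarrow> real"
  shows "sum F {x. P x} = (\<Sum>x\<in>UNIV. of_bool (P x) * F x)"
  by (rule sum.mono_neutral_cong_left) auto

lemma cnt_eq_card: "cnt A x y = card {f \<in> A. ev f x = y}"
  by (simp add: cnt_def Int_def)

lemma sum_cnt: "(\<Sum>y\<in>UNIV. cnt A x y) = card A"
  unfolding cnt_def by (subst sum.swap) simp

lemma sum_cnt_ev:
  "(\<Sum>x\<in>X. cnt A x (ev g x)) = (\<Sum>f\<in>A. real (card {x \<in> X. ev f x = ev g x}))"
  unfolding cnt_def by (subst sum.swap) (simp add: Int_def)

text \<open>Both sides count the pairs from \<open>A\<close> and \<open>B\<close> that agree in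
  column \<open>x\<close>.\<close>

lemma sum_cnt_mult_cnt: "(\<Sum>y\<in>UNIV. cnt A x y * cnt B x y) = (\<Sum>g\<in>B. cnt A x (ev g x))"
proof -
  have "(\<Sum>y\<in>UNIV. cnt A x y * cnt B x y) =
        (\<Sum>g\<in>B. \<Sum>y\<in>UNIV. cnt A x y * of_bool (ev g x = y))"
    unfolding cnt_def[of B] sum_distrib_left by (rule sum.swap)
  also have "\<dots> = (\<Sum>g\<in>B. cnt A x (ev g x))"
    by (intro sum.cong refl) (simp add: of_bool_def if_distrib sum.delta cong: if_cong)
  finally show ?thesis .
qed

lemma sum_cnt_square:
  "(\<Sum>x\<in>X. \<Sum>y\<in>UNIV. (cnt A x y)\<^sup>2) = (\<Sum>g\<in>A. \<Sum>f\<in>A. real (card {x \<in> X. ev f x = ev g x}))"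
  unfolding power2_eq_square sum_cnt_mult_cnt by (subst sum.swap) (simp add: sum_cnt_ev)

text \<open>Two columns of the array are independent of the column \<open>x0\<close>, so centering the columns
  makes all mixed terms vanish.\<close>

lemma sum_square_outside_point:
  fixes w :: "'a::{finite,field} \<Rightarrow> 'a \<Rightarrow> real"
  assumes q: "CARD('a) \<ge> 3" and w: "\<And>x. (\<Sum>y\<in>UNIV. w x y) = 0"
  shows "(\<Sum>g | ev g x0 \<noteq> y0. (\<Sum>x\<in>-{x0}. w x (ev g x))\<^sup>2) =
         (real CARD('a) - 1) * real CARD('a) * (\<Sum>x\<in>-{x0}. \<Sum>y\<in>UNIV. (w x y)\<^sup>2)"
proof -
  let ?q = "real CARD('a)"
  have col: "(\<Sum>g\<in>UNIV. of_bool (ev g x0 \<noteq> y0) * (w x (ev g x) * w x' (ev g x'))) =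
      (if x = x' then (?q - 1) * ?q * (\<Sum>y\<in>UNIV. (w x y)\<^sup>2) else 0)"
    if x: "x \<noteq> x0" "x' \<noteq> x0" for x x'
  proof (cases "x = x'")
    case True
    \<comment> \<open>Only two columns occur here, but interpolation needs a third node; it exists
      because the field has at least three elements.\<close>
    have "card {x0, x} < CARD('a)" using q card_insert_le_m1[of 2 "{x}" x0] by simp
    then obtain x2 where x2: "x2 \<notin> {x0, x}"
      by (metis UNIV_eq_I nat_less_le)
    have "(\<Sum>g\<in>UNIV. of_bool (ev g x0 \<noteq> y0) * (w x (ev g x) * w x (ev g x))) =
        (\<Sum>z\<in>UNIV. \<Sum>y\<in>UNIV. \<Sum>y'\<in>(UNIV::'a set). of_bool (z \<noteq> y0) * (w x y * w x y))"
      using sum_interpolation[where F = "\<lambda>z y y'. of_bool (z \<noteq> y0) * (w x y * w x y)"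
          and ?x0.0 = x0 and ?x1.0 = x and ?x2.0 = x2] x x2 by auto
    also have "\<dots> = (\<Sum>z\<in>UNIV. of_bool (z \<noteq> y0) * (?q * (\<Sum>y\<in>UNIV. (w x y)\<^sup>2)))"
      by (simp add: sum_distrib_left power2_eq_square mult_ac)
    also have "\<dots> = (\<Sum>z\<in>UNIV. of_bool (z \<noteq> y0)) * (?q * (\<Sum>y\<in>UNIV. (w x y)\<^sup>2))"
      by (rule sum_distrib_right[symmetric])
    also have "(\<Sum>z\<in>UNIV. of_bool (z \<noteq> y0)) = real (card (-{y0}))"
      by (simp add: Compl_eq)
    finally show ?thesis using True card_Compl_singleton[of y0] by simp
  next
    case False
    have "(\<Sum>g\<in>UNIV. of_bool (ev g x0 \<noteq> y0) * (w x (ev g x) * w x' (ev g x'))) =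
        (\<Sum>z\<in>UNIV. \<Sum>y\<in>UNIV. \<Sum>y'\<in>UNIV. of_bool (z \<noteq> y0) * (w x y * w x' y'))"
      using sum_interpolation[where F = "\<lambda>z y y'. of_bool (z \<noteq> y0) * (w x y * w x' y')"
          and ?x0.0 = x0 and ?x1.0 = x and ?x2.0 = x'] x False by auto
    also have "\<dots> = 0"
      by (simp add: sum_distrib_left[symmetric] w)
    finally show ?thesis using False by simp
  qed
  have "(\<Sum>g | ev g x0 \<noteq> y0. (\<Sum>x\<in>-{x0}. w x (ev g x))\<^sup>2) =
        (\<Sum>g\<in>UNIV. of_bool (ev g x0 \<noteq> y0) * (\<Sum>x\<in>-{x0}. w x (ev g x))\<^sup>2)"
    by (rule sum_Collect_of_bool)
  also have "\<dots> = (\<Sum>g\<in>UNIV. \<Sum>x\<in>-{x0}. \<Sum>x'\<in>-{x0}.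
        of_bool (ev g x0 \<noteq> y0) * (w x (ev g x) * w x' (ev g x')))"
    unfolding power2_eq_square sum_product by (simp only: sum_distrib_left)
  also have "\<dots> = (\<Sum>x\<in>-{x0}. \<Sum>x'\<in>-{x0}. \<Sum>g\<in>UNIV.
        of_bool (ev g x0 \<noteq> y0) * (w x (ev g x) * w x' (ev g x')))"
    by (subst sum.swap, intro sum.cong refl, rule sum.swap)
  also have "\<dots> = (\<Sum>x\<in>-{x0}. \<Sum>x'\<in>-{x0}.
        if x = x' then (?q - 1) * ?q * (\<Sum>y\<in>UNIV. (w x y)\<^sup>2) else 0)"
    by (intro sum.cong refl col) auto
  also have "\<dots> = (\<Sum>x\<in>-{x0}. (?q - 1) * ?q * (\<Sum>y\<in>UNIV. (w x y)\<^sup>2))"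
    by (intro sum.cong refl) (simp add: sum.delta)
  finally show ?thesis by (simp add: sum_distrib_left)
qed

text \<open>Even among the polynomials avoiding \<open>(x0, y0)\<close>, the value in any other
  column is uniform, so each of the \<open>q - 1\<close> columns has mean count
  \<open>card A / q\<close>. Centering by these means reduces to the preceding lemma.\<close>

lemma variance_outside_point:
  fixes A :: "('a::{finite,field} \<times> 'a \<times> 'a) set"
  assumes q: "CARD('a) \<ge> 3"
  shows "(\<Sum>g | ev g x0 \<noteq> y0.
            ((\<Sum>x\<in>-{x0}. cnt A x (ev g x)) - (real CARD('a) - 1) * card A / CARD('a))\<^sup>2) =
         (real CARD('a) - 1) * (CARD('a) * (\<Sum>x\<in>-{x0}. \<Sum>y\<in>UNIV. (cnt A x y)\<^sup>2)
            - (real CARD('a) - 1) * (real (card A))\<^sup>2)"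
proof -
  let ?q = "real CARD('a)" and ?n = "real (card A)"
  define w where "w x y = cnt A x y - ?n / ?q" for x y
  have q0: "?q > 0" by simp
  have w0: "(\<Sum>y\<in>UNIV. w x y) = 0" for x
    using q0 by (simp add: w_def sum_subtractf sum_cnt)
  have w2: "(\<Sum>y\<in>UNIV. (w x y)\<^sup>2) = (\<Sum>y\<in>UNIV. (cnt A x y)\<^sup>2) - ?n\<^sup>2 / ?q" for x
  proof -
    have "(\<Sum>y\<in>UNIV. (w x y)\<^sup>2) = (\<Sum>y\<in>UNIV. (cnt A x y)\<^sup>2 + (?n / ?q)\<^sup>2 - 2 * (?n / ?q) * cnt A x y)"
      unfolding w_def by (intro sum.cong refl) (simp add: power2_diff algebra_simps)
    also have "\<dots> = (\<Sum>y\<in>UNIV. (cnt A x y)\<^sup>2) + ?q * (?n / ?q)\<^sup>2 - 2 * (?n / ?q) * ?n"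
      unfolding sum.distrib sum_subtractf sum_distrib_left[symmetric] sum_cnt by simp
    finally show ?thesis using q0 by (simp add: power2_eq_square)
  qed
  have "(\<Sum>x\<in>-{x0}. w x (ev g x)) = (\<Sum>x\<in>-{x0}. cnt A x (ev g x)) - (?q - 1) * ?n / ?q" for g
    by (simp add: w_def sum_subtractf card_Compl_singleton)
  then have "(\<Sum>g | ev g x0 \<noteq> y0.
            ((\<Sum>x\<in>-{x0}. cnt A x (ev g x)) - (?q - 1) * ?n / ?q)\<^sup>2) =
         (?q - 1) * ?q * (\<Sum>x\<in>-{x0}. \<Sum>y\<in>UNIV. (w x y)\<^sup>2)"
    using sum_square_outside_point[where w = w, OF q w0, where ?x0.0 = x0 and ?y0.0 = y0] by simp
  also have "(\<Sum>x\<in>-{x0}. \<Sum>y\<in>UNIV. (w x y)\<^sup>2) =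
      (\<Sum>x\<in>-{x0}. \<Sum>y\<in>UNIV. (cnt A x y)\<^sup>2) - (?q - 1) * (?n\<^sup>2 / ?q)"
    by (simp add: w2 sum_subtractf card_Compl_singleton)
  also have "(?q - 1) * ?q * (S - (?q - 1) * (?n\<^sup>2 / ?q)) = (?q - 1) * (?q * S - (?q - 1) * ?n\<^sup>2)" for S
    using q0 by (simp add: field_simps)
  finally show ?thesis .
qed

subsection \<open>Families through a fixed point\<close>

text \<open>Pairs are ordered, and diagonal pairs do not count because \<open>meets f f\<close> is
  the order of the field.\<close>

definition tangents ::
  "('a::{finite,field} \<times> 'a \<times> 'a) set \<Rightarrow> ('a \<times> 'a \<times> 'a) set \<Rightarrow> real" where
  "tangents A B = (\<Sum>f\<in>A. \<Sum>g\<in>B. of_bool (meets f g = 1))"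

lemma card_meets_outside:
  fixes f g :: "'a::{finite,field} \<times> 'a \<times> 'a"
  assumes "f \<noteq> g" "ev f x0 = ev g x0"
  shows "real (card {x \<in> -{x0}. ev f x = ev g x}) = 1 - of_bool (meets f g = 1)"
proof -
  let ?S = "{x. ev f x = ev g x}"
  have "{x \<in> -{x0}. ev f x = ev g x} = ?S - {x0}" by auto
  then have c: "card {x \<in> -{x0}. ev f x = ev g x} = meets f g - 1"
    using assms(2) by (simp add: meets_def)
  have "meets f g > 0" using assms(2) by (auto simp: meets_def card_gt_0_iff)
  then have "meets f g = 1 \<or> meets f g = 2" using meets_le_2[OF assms(1)] by linarith
  then show ?thesis using c by auto
qed

lemma card_meets_outside_eq_meets:
  assumes "ev f x0 \<noteq> ev g x0"
  shows "card {x \<in> -{x0}. ev f x = ev g x} = meets f g"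
proof -
  have "{x \<in> -{x0}. ev f x = ev g x} = {x. ev f x = ev g x}" using assms by auto
  then show ?thesis by (simp add: meets_def)
qed

text \<open>Distinct members through \<open>(x0, y0)\<close> share one further point unless they are
  tangent; a member shares \<open>q - 1\<close> further points with itself, which is
  \<open>q - 2\<close> more than the generic one.\<close>

lemma star_sum_cnt_square:
  fixes A :: "('a::{finite,field} \<times> 'a \<times> 'a) set"
  assumes q: "CARD('a) \<ge> 3" and A: "\<forall>f\<in>A. ev f x0 = y0"
  shows "(\<Sum>x\<in>-{x0}. \<Sum>y\<in>UNIV. (cnt A x y)\<^sup>2) =
    real (card A) * (real CARD('a) - 2) + (real (card A))\<^sup>2 - tangents A A"
proof -
  have "(\<Sum>x\<in>-{x0}. \<Sum>y\<in>UNIV. (cnt A x y)\<^sup>2) =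
      (\<Sum>g\<in>A. \<Sum>f\<in>A. (if f = g then real CARD('a) - 2 else 0) + 1 - of_bool (meets g f = 1))"
    unfolding sum_cnt_square
  proof (intro sum.cong refl)
    fix g f assume "g \<in> A" "f \<in> A"
    then show "real (card {x \<in> -{x0}. ev f x = ev g x}) =
      (if f = g then real CARD('a) - 2 else 0) + 1 - of_bool (meets g f = 1)"
      using A card_meets_outside[of f g x0] card_Compl_singleton[of x0] q
      by (cases "f = g") (auto simp: meets_commute Compl_eq)
  qed
  also have "\<dots> = real (card A) * (real CARD('a) - 2) + (real (card A))\<^sup>2 - tangents A A"
    by (simp add: sum_subtractf sum.distrib tangents_def power2_eq_square algebra_simps)
  finally show ?thesis .
qed

text \<open>Cauchy-Schwarz for the fibre sizes of \<open>p\<close>: the double sum is the sum of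
  their squares.\<close>

lemma card_square_le_fibres:
  fixes p :: "'b \<Rightarrow> 'a::finite"
  assumes "finite A"
  shows "(real (card A))\<^sup>2 \<le> CARD('a) * (\<Sum>f\<in>A. \<Sum>g\<in>A. of_bool (p f = p g))"
proof -
  define c :: "'a \<Rightarrow> real" where "c y = (\<Sum>f\<in>A. of_bool (p f = y))" for y
  have "(\<Sum>y\<in>UNIV. c y) = card A"
    unfolding c_def by (subst sum.swap) simp
  moreover have "(\<Sum>y\<in>UNIV. (c y)\<^sup>2) = (\<Sum>f\<in>A. \<Sum>g\<in>A. \<Sum>y\<in>UNIV. of_bool (p f = y) * of_bool (p g = y))"
    unfolding c_def power2_eq_square sum_product
    by (subst sum.swap, intro sum.cong refl, rule sum.swap)
  moreover have "(\<Sum>y\<in>UNIV. of_bool (p f = y) * of_bool (p g = y)) = (of_bool (p f = p g) :: real)" for f g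
  proof -
    have "(\<Sum>y\<in>UNIV. of_bool (p f = y) * of_bool (p g = y)) =
        (\<Sum>y\<in>UNIV. if y = p f then of_bool (p g = p f) else (0::real))"
      by (intro sum.cong refl) auto
    then show ?thesis by (auto simp: sum.delta)
  qed
  moreover have "(\<Sum>y\<in>UNIV. 1 * c y)\<^sup>2 \<le> (\<Sum>y\<in>(UNIV::'a set). 1\<^sup>2) * (\<Sum>y\<in>UNIV. (c y)\<^sup>2)"
    by (rule Cauchy_Schwarz_ineq_sum)
  ultimately show ?thesis by simp
qed

text \<open>Members through one point are tangent if they agree in the leading coefficient or in the
  derivative at \<open>x0\<close>, and distinct ones cannot agree in both. Each of these maps has
  only \<open>q\<close> values, hence many collisions; the diagonal is removed from both
  counts.\<close>

lemma star_tangents_ge: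
  fixes A :: "('a::{finite,field} \<times> 'a \<times> 'a) set"
  assumes q: "CARD('a) \<ge> 3" and A: "\<forall>f\<in>A. ev f x0 = y0"
  shows "tangents A A \<ge> 2 * (real (card A))\<^sup>2 / CARD('a) - 2 * card A"
proof -
  let ?s = "\<lambda>(a, b, c). 2 * a * x0 + b :: 'a"
  have "of_bool (fst f = fst g) + of_bool (?s f = ?s g) - (if f = g then 2 else 0) \<le>
      (of_bool (meets f g = 1) :: real)" if "f \<in> A" "g \<in> A" for f g
  proof (cases "f = g")
    case False
    have e: "ev f x0 = ev g x0" using that A by simp
    obtain a b c where f: "f = (a, b, c)" by (metis prod_cases3)
    obtain a' b' c' where g: "g = (a', b', c')" by (metis prod_cases3)
    have "\<not> (fst f = fst g \<and> ?s f = ?s g)"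
      using False e f g by auto
    moreover have "meets f g = 1" if "fst f = fst g"
      using meets_eq_1_same_leading_coeff[OF e False that] .
    moreover have "meets f g = 1" if "?s f = ?s g"
      using meets_eq_1_same_slope[of a b c x0 a' b' c'] e f g that False by simp
    ultimately show ?thesis using False by auto
  qed simp
  then have "(\<Sum>f\<in>A. \<Sum>g\<in>A. of_bool (fst f = fst g) + of_bool (?s f = ?s g) - (if f = g then 2 else 0))
      \<le> tangents A A"
    unfolding tangents_def by (intro sum_mono) auto
  then have *: "(\<Sum>f\<in>A. \<Sum>g\<in>A. of_bool (fst f = fst g)) + (\<Sum>f\<in>A. \<Sum>g\<in>A. of_bool (?s f = ?s g)) - 2 * real (card A)
      \<le> tangents A A"
    by (simp add: sum_subtractf sum.distrib sum.delta')
  have "(real (card A))\<^sup>2 / CARD('a) \<le> (\<Sum>f\<in>A. \<Sum>g\<in>A. of_bool (fst f = fst g))"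
    "(real (card A))\<^sup>2 / CARD('a) \<le> (\<Sum>f\<in>A. \<Sum>g\<in>A. of_bool (?s f = ?s g))"
    using card_square_le_fibres[of A fst] card_square_le_fibres[of A ?s]
    by (simp_all add: divide_le_eq mult.commute)
  then show ?thesis using * by simp
qed

text \<open>Each \<open>g\<close> in \<open>B\<close> meets the members of \<open>A\<close> in
  \<open>2n\<close> points less its tangencies, far above the mean \<open>(q - 1) * n / q\<close>.
  Cauchy-Schwarz over \<open>B\<close>, followed by enlarging \<open>B\<close> to all polynomials
  avoiding the point, compares the total deviation with the variance.\<close>

lemma star_outside_inequality:
  fixes A B :: "('a::{finite,field} \<times> 'a \<times> 'a) set"
  assumes q: "CARD('a) \<ge> 3" and A: "\<forall>f\<in>A. ev f x0 = y0" and B: "\<forall>g\<in>B. ev g x0 \<noteq> y0"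
    and int: "\<forall>f\<in>A. \<forall>g\<in>B. meets f g > 0"
  shows "(real (card B) * (card A * (1 + 1 / CARD('a))) - tangents A B)\<^sup>2 \<le>
    card B * ((real CARD('a) - 1) * (card A * ((real CARD('a))\<^sup>2 - card A)))"
proof -
  let ?q = "real CARD('a)" and ?n = "real (card A)"
  define e where "e g = (\<Sum>x\<in>-{x0}. cnt A x (ev g x)) - (?q - 1) * ?n / ?q" for g
  have q0: "?q > 1" using q by simp
  have "e g = ?n * (1 + 1 / ?q) - (\<Sum>f\<in>A. of_bool (meets f g = 1))" if g: "g \<in> B" for g
  proof -
    have "(\<Sum>x\<in>-{x0}. cnt A x (ev g x)) = (\<Sum>f\<in>A. 2 - of_bool (meets f g = 1))"
      unfolding sum_cnt_ev
    proof (intro sum.cong refl)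
      fix f assume f: "f \<in> A"
      then have ne: "ev f x0 \<noteq> ev g x0" using A B g by auto
      have "meets f g = 1 \<or> meets f g = 2"
        using meets_le_2[of f g] int f g ne by fastforce
      then show "real (card {x \<in> -{x0}. ev f x = ev g x}) = 2 - of_bool (meets f g = 1)"
        using card_meets_outside_eq_meets[OF ne] by auto
    qed
    also have "\<dots> = 2 * ?n - (\<Sum>f\<in>A. of_bool (meets f g = 1))"
      by (simp add: sum_subtractf del: sum_of_bool_eq)
    finally have "e g = 2 * ?n - (\<Sum>f\<in>A. of_bool (meets f g = 1)) - (?q - 1) * ?n / ?q"
      by (simp add: e_def)
    moreover have "2 * ?n - (?q - 1) * ?n / ?q = ?n * (1 + 1 / ?q)"
      using q0 by (simp add: field_simps)
    ultimately show ?thesis by linarith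
  qed
  then have "(\<Sum>g\<in>B. e g) = card B * (?n * (1 + 1 / ?q)) - (\<Sum>g\<in>B. \<Sum>f\<in>A. of_bool (meets f g = 1))"
    by (simp add: sum_subtractf)
  also have "(\<Sum>g\<in>B. \<Sum>f\<in>A. of_bool (meets f g = 1)) = tangents A B"
    unfolding tangents_def by (rule sum.swap)
  finally have "(real (card B) * (?n * (1 + 1 / ?q)) - tangents A B)\<^sup>2 = (\<Sum>g\<in>B. 1 * e g)\<^sup>2"
    by simp
  also have "\<dots> \<le> (\<Sum>g\<in>B. 1\<^sup>2) * (\<Sum>g\<in>B. (e g)\<^sup>2)"
    by (rule Cauchy_Schwarz_ineq_sum)
  also have "\<dots> \<le> card B * (\<Sum>g | ev g x0 \<noteq> y0. (e g)\<^sup>2)"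
    using B by (auto intro!: mult_left_mono sum_mono2)
  also have "(\<Sum>g | ev g x0 \<noteq> y0. (e g)\<^sup>2) =
      (?q - 1) * (?q * (?n * (?q - 2) + ?n\<^sup>2 - tangents A A) - (?q - 1) * ?n\<^sup>2)"
    unfolding e_def variance_outside_point[OF q] star_sum_cnt_square[OF q A] ..
  \<comment> \<open>Tangent pairs inside \<open>A\<close> lower the variance; in their lower bound
    the terms \<open>2 * q * n\<close> cancel.\<close>
  also have "\<dots> \<le> (?q - 1) * (?n * (?q\<^sup>2 - ?n))"
  proof (rule mult_left_mono)
    have "?q * (2 * ?n\<^sup>2 / ?q - 2 * ?n) \<le> ?q * tangents A A"
      using star_tangents_ge[OF q A] by (intro mult_left_mono) auto
    then have "2 * ?n\<^sup>2 - 2 * ?q * ?n \<le> ?q * tangents A A"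
      using q0 by (simp add: right_diff_distrib)
    then show "?q * (?n * (?q - 2) + ?n\<^sup>2 - tangents A A) - (?q - 1) * ?n\<^sup>2 \<le> ?n * (?q\<^sup>2 - ?n)"
      by (simp add: algebra_simps power2_eq_square)
  qed (use q0 in simp)
  finally show ?thesis by (simp add: mult_left_mono)
qed

text \<open>First and second factorial moments over the polynomials through \<open>(x0, y0)\<close>:
  prescribing one further value leaves \<open>q\<close> of them, prescribing two leaves exactly
  one.\<close>

lemma star_sum_meets:
  fixes g :: "'a::{finite,field} \<times> 'a \<times> 'a"
  assumes q: "CARD('a) \<ge> 3" and g: "ev g x0 \<noteq> y0"
  shows "(\<Sum>f | ev f x0 = y0. real (meets f g)) = CARD('a) * (real CARD('a) - 1)"
    and "(\<Sum>f | ev f x0 = y0. real (meets f g) * (real (meets f g) - 1)) =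
      (real CARD('a) - 1) * (real CARD('a) - 2)"
proof -
  let ?q = "real CARD('a)"
  have m: "real (meets f g) = (\<Sum>x\<in>-{x0}. of_bool (ev f x = ev g x))" if "ev f x0 = y0" for f
    using card_meets_outside_eq_meets[of f x0 g] that g by (simp add: Int_def)
  have pair: "(\<Sum>f | ev f x0 = y0. of_bool (ev f x = ev g x) * of_bool (ev f x' = ev g x')) =
      (if x = x' then ?q else 1)" if x: "x \<noteq> x0" "x' \<noteq> x0" for x x'
  proof -
    have s: "(\<Sum>f | ev f x0 = y0. of_bool (ev f x = ev g x) * of_bool (ev f x' = ev g x')) =
      (\<Sum>f\<in>UNIV. of_bool (ev f x0 = y0) * (of_bool (ev f x = ev g x) * of_bool (ev f x' = ev g x')) :: real)"
      by (rule sum_Collect_of_bool)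
    show ?thesis
    proof (cases "x = x'")
      case True
      have "card {x0, x} < CARD('a)" using q card_insert_le_m1[of 2 "{x}" x0] by simp
      then obtain x2 where x2: "x2 \<notin> {x0, x}" by (metis UNIV_eq_I nat_less_le)
      have "(\<Sum>f\<in>UNIV. of_bool (ev f x0 = y0) * (of_bool (ev f x = ev g x) * of_bool (ev f x' = ev g x')) :: real) =
        (\<Sum>z\<in>UNIV. \<Sum>y\<in>UNIV. \<Sum>y'\<in>(UNIV::'a set). of_bool (z = y0) * of_bool (y = ev g x))"
        using sum_interpolation[where F = "\<lambda>z y y'. of_bool (z = y0) * of_bool (y = ev g x)"
          and ?x0.0 = x0 and ?x1.0 = x and ?x2.0 = x2] x x2 True
        by (auto simp flip: of_bool_conj)
      also have "\<dots> = ?q"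
        by (simp add: sum_distrib_left[symmetric])
      finally show ?thesis unfolding s by (simp only: True refl if_True)
    next
      case False
      have "(\<Sum>f\<in>UNIV. of_bool (ev f x0 = y0) * (of_bool (ev f x = ev g x) * of_bool (ev f x' = ev g x')) :: real) =
        (\<Sum>z\<in>UNIV. \<Sum>y\<in>UNIV. \<Sum>y'\<in>(UNIV::'a set). of_bool (z = y0) * (of_bool (y = ev g x) * of_bool (y' = ev g x')))"
        using sum_interpolation[where F = "\<lambda>z y y'. of_bool (z = y0) * (of_bool (y = ev g x) * of_bool (y' = ev g x'))"
          and ?x0.0 = x0 and ?x1.0 = x and ?x2.0 = x'] x False by auto
      also have "\<dots> = 1"
        by (simp add: sum_distrib_left[symmetric])
      finally show ?thesis unfolding s by (simp only: False if_False)
    qed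
  qed
  have "(\<Sum>f | ev f x0 = y0. real (meets f g)) =
      (\<Sum>f | ev f x0 = y0. \<Sum>x\<in>-{x0}. of_bool (ev f x = ev g x) * of_bool (ev f x = ev g x))"
  proof (intro sum.cong refl)
    fix f assume "f \<in> {f. ev f x0 = y0}"
    then have "real (meets f g) = (\<Sum>x\<in>-{x0}. of_bool (ev f x = ev g x))" using m by simp
    also have "\<dots> = (\<Sum>x\<in>-{x0}. of_bool (ev f x = ev g x) * of_bool (ev f x = ev g x))"
      by (intro sum.cong refl) auto
    finally show "real (meets f g) = (\<Sum>x\<in>-{x0}. of_bool (ev f x = ev g x) * of_bool (ev f x = ev g x))" .
  qed
  also have "\<dots> = (\<Sum>x\<in>-{x0}. ?q)"
    by (subst sum.swap, intro sum.cong refl) (subst pair, auto)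
  also have "\<dots> = ?q * (?q - 1)" using card_Compl_singleton[of x0] by simp
  finally show 1: "(\<Sum>f | ev f x0 = y0. real (meets f g)) = ?q * (?q - 1)" .
  have "(\<Sum>f | ev f x0 = y0. (real (meets f g))\<^sup>2) =
      (\<Sum>f | ev f x0 = y0. \<Sum>x\<in>-{x0}. \<Sum>x'\<in>-{x0}. of_bool (ev f x = ev g x) * of_bool (ev f x' = ev g x'))"
    by (intro sum.cong refl) (simp add: m power2_eq_square sum_product del: sum_of_bool_eq)
  also have "\<dots> = (\<Sum>x\<in>-{x0}. \<Sum>x'\<in>-{x0}.
      \<Sum>f | ev f x0 = y0. of_bool (ev f x = ev g x) * of_bool (ev f x' = ev g x'))"
    by (subst sum.swap, intro sum.cong refl, rule sum.swap)
  also have "\<dots> = (\<Sum>x\<in>-{x0}. \<Sum>x'\<in>-{x0}. (if x = x' then ?q - 1 else 0) + 1)"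
    by (intro sum.cong refl) (subst pair, auto)
  also have "\<dots> = (\<Sum>x\<in>-{x0}. (?q - 1) + (?q - 1))"
  proof (intro sum.cong refl)
    fix x assume "x \<in> -{x0}"
    then show "(\<Sum>x'\<in>-{x0}. (if x = x' then ?q - 1 else 0) + 1) = (?q - 1) + (?q - 1)"
      using card_Compl_singleton[of x0] by (subst sum.distrib) (simp add: sum.delta)
  qed
  also have "\<dots> = (?q - 1) * (2 * (?q - 1))"
    using card_Compl_singleton[of x0] by simp
  finally have 2: "(\<Sum>f | ev f x0 = y0. (real (meets f g))\<^sup>2) = (?q - 1) * (2 * (?q - 1))" .
  have "(\<Sum>f | ev f x0 = y0. real (meets f g) * (real (meets f g) - 1)) =
      (\<Sum>f | ev f x0 = y0. (real (meets f g))\<^sup>2) - (\<Sum>f | ev f x0 = y0. real (meets f g))"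
    by (simp add: sum_subtractf[symmetric] power2_eq_square algebra_simps)
  then show "(\<Sum>f | ev f x0 = y0. real (meets f g) * (real (meets f g) - 1)) = (?q - 1) * (?q - 2)"
    unfolding 1 2 by (simp add: algebra_simps)
qed

text \<open>For \<open>m\<close> in {0, 1, 2}, \<open>m - m * (m - 1) / 2\<close> is the indicator
  of \<open>m > 0\<close> and \<open>m * (m - 1) / 2\<close> that of \<open>m = 2\<close>. The two
  moments therefore count exactly the polynomials through the point that meet \<open>g\<close> at
  all, respectively twice.\<close>

lemma star_meeting_outside:
  fixes A :: "('a::{finite,field} \<times> 'a \<times> 'a) set"
  assumes q: "CARD('a) \<ge> 3" and A: "\<forall>f\<in>A. ev f x0 = y0" and g: "ev g x0 \<noteq> y0"
    and int: "\<forall>f\<in>A. meets f g > 0"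
  shows "real (card A) \<le> (real CARD('a) - 1) * (real CARD('a) + 2) / 2"
    and "real (card A) - (\<Sum>f\<in>A. of_bool (meets f g = 1)) \<le> (real CARD('a) - 1) * (real CARD('a) - 2) / 2"
proof -
  let ?q = "real CARD('a)"
  let ?m = "\<lambda>f. real (meets f g)"
  have sub: "A \<subseteq> {f. ev f x0 = y0}" using A by auto
  have m2: "meets f g \<in> {0, 1, 2}" if "ev f x0 = y0" for f
    using meets_le_2[of f g] that g by fastforce
  have "real (card A) = (\<Sum>f\<in>A. ?m f - ?m f * (?m f - 1) / 2)"
  proof -
    have "?m f - ?m f * (?m f - 1) / 2 = 1" if "f \<in> A" for f
      using m2[of f] int A that by fastforce
    then show ?thesis by simp
  qed
  also have "\<dots> \<le> (\<Sum>f | ev f x0 = y0. ?m f - ?m f * (?m f - 1) / 2)"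
  proof (rule sum_mono2)
    fix f assume "f \<in> {f. ev f x0 = y0} - A"
    then have "meets f g \<in> {0, 1, 2}" using m2 by simp
    then show "0 \<le> ?m f - ?m f * (?m f - 1) / 2" by auto
  qed (use sub in auto)
  also have "\<dots> = ?q * (?q - 1) - (?q - 1) * (?q - 2) / 2"
    by (simp add: sum_subtractf star_sum_meets[OF q g] flip: sum_divide_distrib)
  finally show "real (card A) \<le> (?q - 1) * (?q + 2) / 2" by (simp add: field_simps)
  have "real (card A) - (\<Sum>f\<in>A. of_bool (meets f g = 1)) = (\<Sum>f\<in>A. ?m f * (?m f - 1) / 2)"
  proof -
    have "1 - of_bool (meets f g = 1) = ?m f * (?m f - 1) / 2" if "f \<in> A" for f
      using m2[of f] int A that by fastforce
    then have "(\<Sum>f\<in>A. 1 - of_bool (meets f g = 1)) = (\<Sum>f\<in>A. ?m f * (?m f - 1) / 2)"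
      by (intro sum.cong refl) auto
    then show ?thesis by (simp add: sum_subtractf)
  qed
  also have "\<dots> \<le> (\<Sum>f | ev f x0 = y0. ?m f * (?m f - 1) / 2)"
  proof (rule sum_mono2)
    fix f assume "f \<in> {f. ev f x0 = y0} - A"
    then have "meets f g \<in> {0, 1, 2}" using m2 by simp
    then show "0 \<le> ?m f * (?m f - 1) / 2" by auto
  qed (use sub in auto)
  also have "\<dots> = (?q - 1) * (?q - 2) / 2"
    by (simp add: star_sum_meets[OF q g] flip: sum_divide_distrib)
  finally show "real (card A) - (\<Sum>f\<in>A. of_bool (meets f g = 1)) \<le> (?q - 1) * (?q - 2) / 2" .
qed

subsection \<open>Tangent pairs in odd characteristic\<close>

fun dot :: "'a::field \<times> 'a \<times> 'a \<Rightarrow> 'a \<times> 'a \<times> 'a \<Rightarrow> 'a" where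
  "dot (u, v, w) (a, b, c) = u * a + v * b + w * c"

text \<open>A functional \<open>k\<close> on the coefficient space may vanish on \<open>(x - r)\<^sup>2\<close>, whose coefficients are
  \<open>(1, -2r, r\<^sup>2)\<close>; \<open>roots k\<close> counts these \<open>r\<close>, and \<open>parallel r f\<close> says that \<open>f\<close> is a multiple of
  \<open>(x - r)\<^sup>2\<close>.\<close>

fun parallel :: "'a::field \<Rightarrow> 'a \<times> 'a \<times> 'a \<Rightarrow> bool" where
  "parallel r (a, b, c) \<longleftrightarrow> b = - 2 * r * a \<and> c = r\<^sup>2 * a"

definition roots :: "'a::{finite,field} \<times> 'a \<times> 'a \<Rightarrow> real" where
  "roots k = (\<Sum>r\<in>UNIV. of_bool (dot k (1, - 2 * r, r\<^sup>2) = 0))"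

text \<open>The subtracted term is the number of agreeing pairs expected if \<open>dot k\<close>
  took independent uniform values.\<close>

definition excess :: "('a::{finite,field} \<times> 'a \<times> 'a) set \<Rightarrow> ('a \<times> 'a \<times> 'a) set
    \<Rightarrow> 'a \<times> 'a \<times> 'a \<Rightarrow> real" where
  "excess A B k = (\<Sum>f\<in>A. \<Sum>g\<in>B. of_bool (dot k f = dot k g)) - card A * card B / CARD('a)"

lemma dot_diff: "dot k (f - g) = dot k f - dot k g"
  by (cases k; cases f; cases g) (simp add: algebra_simps)

lemma dot_0 [simp]: "dot (0, 0, 0) f = 0" "dot 0 f = 0"
  by (cases f, simp add: zero_prod_def)+

text \<open>These functionals are the multiples of evaluation at \<open>x\<close>; they lie on the
  cone \<open>v\<^sup>2 = u * w\<close>.\<close>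

lemma dot_cone: "dot (l * x\<^sup>2, l * x, l) f = l * ev f x"
  by (cases f) (simp add: algebra_simps)

lemma sum_UNIV_prod:
  fixes F :: "'a::finite \<Rightarrow> 'b::finite \<Rightarrow> real"
  shows "(\<Sum>p\<in>UNIV. F (fst p) (snd p)) = (\<Sum>x\<in>UNIV. \<Sum>y\<in>UNIV. F x y)"
  by (simp add: UNIV_Times_UNIV[symmetric] sum.cartesian_product split_def del: UNIV_Times_UNIV)

lemma sum_UNIV_triple:
  fixes F :: "'a::finite \<times> 'b::finite \<times> 'c::finite \<Rightarrow> real"
  shows "(\<Sum>p\<in>UNIV. F p) = (\<Sum>x\<in>UNIV. \<Sum>y\<in>UNIV. \<Sum>z\<in>UNIV. F (x, y, z))"
  using sum_UNIV_prod[where F = "\<lambda>x yz. F (x, yz)"]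
    sum_UNIV_prod[where F = "\<lambda>y z. F (_, y, z)"] by simp

section \<open>Counting functionals with prescribed zeros\<close>

lemma sum_of_bool_linear1:
  fixes p t :: "'a::{finite,field}"
  shows "(\<Sum>x\<in>UNIV. of_bool (x * p + t = 0)) = (if p = 0 then CARD('a) * of_bool (t = 0) else (1::real))"
proof (cases "p = 0")
  case False
  then have "{x. x * p + t = 0} = {- t / p}" by (auto simp: field_simps eq_neg_iff_add_eq_0)
  then show ?thesis using False by simp
qed simp

lemma sum_of_bool_linear2:
  fixes p s t :: "'a::{finite,field}"
  shows "(\<Sum>y\<in>UNIV. \<Sum>x\<in>UNIV. of_bool (x * p + y * s + t = 0)) =
    (if p = 0 \<and> s = 0 then (real CARD('a))\<^sup>2 * of_bool (t = 0) else real CARD('a))"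
proof (cases "p = 0")
  case True
  then have "(\<Sum>y\<in>UNIV. \<Sum>x\<in>UNIV. of_bool (x * p + y * s + t = 0)) =
      (\<Sum>y\<in>(UNIV::'a set). real CARD('a) * of_bool (y * s + t = 0))" by simp
  also have "\<dots> = real CARD('a) * (\<Sum>y\<in>(UNIV::'a set). of_bool (y * s + t = 0))"
    by (rule sum_distrib_left[symmetric])
  finally show ?thesis unfolding sum_of_bool_linear1 using True by (simp add: power2_eq_square)
next
  case False
  have "(\<Sum>x\<in>UNIV. of_bool (x * p + y * s + t = 0)) = (1::real)" for y
    using sum_of_bool_linear1[of p "y * s + t"] False by (simp add: add.assoc)
  then show ?thesis using False by simp
qed

lemma sum_of_bool_dot:
  fixes v :: "'a::{finite,field} \<times> 'a \<times> 'a"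
  shows "(\<Sum>k\<in>UNIV. of_bool (dot k v = 0)) =
    (if v = 0 then (real CARD('a))^3 else (real CARD('a))\<^sup>2)"
proof -
  obtain a b c where v: "v = (a, b, c)" by (metis prod_cases3)
  have "(\<Sum>k\<in>UNIV. of_bool (dot k v = 0)) =
      (\<Sum>x\<in>UNIV. \<Sum>y\<in>UNIV. \<Sum>z\<in>UNIV. of_bool (z * c + y * b + x * a = 0) :: real)"
    unfolding sum_UNIV_triple v by (simp only: dot.simps add_ac)
  also have "\<dots> = (\<Sum>x\<in>UNIV. if c = 0 \<and> b = 0 then (real CARD('a))\<^sup>2 * of_bool (x * a + 0 = 0)
      else real CARD('a))"
    unfolding sum_of_bool_linear2 by (simp only: add_0_right)
  also have "\<dots> = (if v = 0 then (real CARD('a))^3 else (real CARD('a))\<^sup>2)"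
  proof (cases "c = 0 \<and> b = 0")
    case True
    then show ?thesis unfolding v using sum_of_bool_linear1[of a 0]
      by (simp add: zero_prod_def sum_distrib_left[symmetric] power2_eq_square power3_eq_cube)
  qed (auto simp: v zero_prod_def power2_eq_square)
  finally show ?thesis .
qed

text \<open>The direction has first coordinate 1, so its equation can be solved for
  \<open>x\<close>. One linear equation in \<open>y\<close> and \<open>z\<close> remains, and its
  coefficients both vanish exactly when \<open>v\<close> is a multiple of the direction.\<close>

lemma sum_of_bool_dot_direction:
  fixes v :: "'a::{finite,field} \<times> 'a \<times> 'a"
  shows "(\<Sum>k\<in>UNIV. of_bool (dot k (1, - 2 * r, r\<^sup>2) = 0) * of_bool (dot k v = 0)) =
    (if parallel r v then (real CARD('a))\<^sup>2 else real CARD('a))"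
proof -
  obtain a b c where v: "v = (a, b, c)" by (metis prod_cases3)
  have inner: "(\<Sum>x\<in>UNIV. of_bool (dot (x, y, z) (1, - 2 * r, r\<^sup>2) = 0) * of_bool (dot (x, y, z) v = 0)) =
      (of_bool (y * (b + 2 * r * a) + z * (c - r\<^sup>2 * a) + 0 = 0) :: real)" for y z
  proof -
    have "dot (x, y, z) (1, - 2 * r, r\<^sup>2) = 0 \<longleftrightarrow> x = 2 * r * y - r\<^sup>2 * z" for x
      by (simp add: algebra_simps eq_neg_iff_add_eq_0)
    then have "(\<Sum>x\<in>UNIV. of_bool (dot (x, y, z) (1, - 2 * r, r\<^sup>2) = 0) * of_bool (dot (x, y, z) v = 0)) =
      (\<Sum>x\<in>UNIV. if x = 2 * r * y - r\<^sup>2 * z then of_bool (dot (2 * r * y - r\<^sup>2 * z, y, z) v = 0) else (0::real))"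
      by (intro sum.cong refl) auto
    also have "\<dots> = of_bool (dot (2 * r * y - r\<^sup>2 * z, y, z) v = 0)" by (simp add: sum.delta)
    finally show ?thesis by (simp add: v algebra_simps)
  qed
  have "(\<Sum>k\<in>UNIV. of_bool (dot k (1, - 2 * r, r\<^sup>2) = 0) * of_bool (dot k v = 0)) =
      (\<Sum>x\<in>UNIV. \<Sum>y\<in>UNIV. \<Sum>z\<in>UNIV. of_bool (dot (x, y, z) (1, - 2 * r, r\<^sup>2) = 0) * of_bool (dot (x, y, z) v = 0) :: real)"
    unfolding sum_UNIV_triple ..
  also have "\<dots> = (\<Sum>x\<in>UNIV. \<Sum>z\<in>UNIV. \<Sum>y\<in>UNIV. of_bool (dot (x, y, z) (1, - 2 * r, r\<^sup>2) = 0) * of_bool (dot (x, y, z) v = 0))"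
    by (intro sum.cong refl sum.swap)
  also have "\<dots> = (\<Sum>z\<in>UNIV. \<Sum>x\<in>UNIV. \<Sum>y\<in>UNIV. of_bool (dot (x, y, z) (1, - 2 * r, r\<^sup>2) = 0) * of_bool (dot (x, y, z) v = 0))"
    by (rule sum.swap)
  also have "\<dots> = (\<Sum>z\<in>UNIV. \<Sum>y\<in>UNIV. \<Sum>x\<in>UNIV. of_bool (dot (x, y, z) (1, - 2 * r, r\<^sup>2) = 0) * of_bool (dot (x, y, z) v = 0))"
    by (intro sum.cong refl sum.swap)
  also have "\<dots> = (\<Sum>z\<in>UNIV. \<Sum>y\<in>UNIV. of_bool (y * (b + 2 * r * a) + z * (c - r\<^sup>2 * a) + 0 = 0))"
    unfolding inner ..
  also have "\<dots> = (if parallel r v then (real CARD('a))\<^sup>2 else real CARD('a))"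
    unfolding sum_of_bool_linear2 v by (auto simp: eq_neg_iff_add_eq_0)
  finally show ?thesis .
qed

text \<open>Distinct triples agree under \<open>q\<^sup>2\<close> of the \<open>q^3\<close>
  functionals, exactly the rate that \<open>excess\<close> subtracts. Only the diagonal pairs
  remain, and \<open>A \<subseteq> U\<close> provides one for each member of
  \<open>A\<close>.\<close>

lemma sum_excess:
  fixes A U :: "('a::{finite,field} \<times> 'a \<times> 'a) set"
  assumes "A \<subseteq> U"
  shows "(\<Sum>k\<in>UNIV. excess A U k) = ((real CARD('a))^3 - (real CARD('a))\<^sup>2) * card A"
proof -
  let ?q = "real CARD('a)"
  have "(\<Sum>k\<in>UNIV. \<Sum>f\<in>A. \<Sum>g\<in>U. of_bool (dot k f = dot k g)) =
      (\<Sum>f\<in>A. \<Sum>g\<in>U. \<Sum>k\<in>UNIV. of_bool (dot k f = dot k g) :: real)"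
    by (subst sum.swap, rule sum.cong[OF refl], rule sum.swap)
  also have "\<dots> = (\<Sum>f\<in>A. \<Sum>g\<in>U. ?q\<^sup>2 + (if f = g then ?q^3 - ?q\<^sup>2 else 0))"
  proof (intro sum.cong refl)
    fix f g :: "'a \<times> 'a \<times> 'a"
    have "(\<Sum>k\<in>UNIV. of_bool (dot k f = dot k g)) = (\<Sum>k\<in>UNIV. of_bool (dot k (f - g) = 0) :: real)"
      by (simp only: dot_diff right_minus_eq)
    then show "(\<Sum>k\<in>UNIV. of_bool (dot k f = dot k g)) = ?q\<^sup>2 + (if f = g then ?q^3 - ?q\<^sup>2 else 0)"
      unfolding sum_of_bool_dot by simp
  qed
  also have "\<dots> = (\<Sum>f\<in>A. card U * ?q\<^sup>2 + (?q^3 - ?q\<^sup>2))"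
  proof (intro sum.cong refl)
    fix f assume "f \<in> A"
    then have "f \<in> U" using assms by auto
    then show "(\<Sum>g\<in>U. ?q\<^sup>2 + (if f = g then ?q^3 - ?q\<^sup>2 else 0)) = card U * ?q\<^sup>2 + (?q^3 - ?q\<^sup>2)"
      by (simp add: sum.distrib sum.delta')
  qed
  also have "\<dots> = card A * card U * ?q\<^sup>2 + (?q^3 - ?q\<^sup>2) * card A"
    by (simp add: algebra_simps)
  finally have *: "(\<Sum>k\<in>UNIV. \<Sum>f\<in>A. \<Sum>g\<in>U. of_bool (dot k f = dot k g)) =
      card A * card U * ?q\<^sup>2 + (?q^3 - ?q\<^sup>2) * card A" .
  have "(\<Sum>k\<in>(UNIV :: ('a \<times> 'a \<times> 'a) set). card A * card U / ?q) = card A * card U * ?q\<^sup>2"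
    by (simp add: power2_eq_square)
  then show ?thesis unfolding excess_def sum_subtractf * by linarith
qed

text \<open>Among the \<open>q\<^sup>2\<close> functionals vanishing on the direction of
  \<open>r\<close>, a pair not parallel to it agrees under \<open>q\<close>, the expected rate, and
  a parallel pair under all of them. So each parallel pair contributes
  \<open>q\<^sup>2 - q\<close>.\<close>

lemma sum_roots_excess:
  fixes A U :: "('a::{finite,field} \<times> 'a \<times> 'a) set"
  shows "(\<Sum>k\<in>UNIV. roots k * excess A U k) =
    ((real CARD('a))\<^sup>2 - CARD('a)) * (\<Sum>r\<in>UNIV. \<Sum>f\<in>A. \<Sum>g\<in>U. of_bool (parallel r (f - g)))"
proof -
  let ?q = "real CARD('a)"
  let ?d = "\<lambda>k r. of_bool (dot k (1, - 2 * r, r\<^sup>2) = 0) :: real"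
  have R: "(\<Sum>k\<in>UNIV. ?d k r) = ?q\<^sup>2" for r :: 'a
    using sum_of_bool_dot[of "(1, - 2 * r, r\<^sup>2)"] by (simp add: zero_prod_def)
  have "(\<Sum>k\<in>UNIV. roots k * excess A U k) = (\<Sum>k\<in>UNIV. \<Sum>r\<in>UNIV. ?d k r * excess A U k)"
    unfolding roots_def sum_distrib_right ..
  also have "\<dots> = (\<Sum>r\<in>UNIV. \<Sum>k\<in>UNIV. ?d k r * excess A U k)" by (rule sum.swap)
  also have "\<dots> = (\<Sum>r\<in>UNIV. (?q\<^sup>2 - ?q) * (\<Sum>f\<in>A. \<Sum>g\<in>U. of_bool (parallel r (f - g))))"
  proof (intro sum.cong refl)
    fix r
    have "(\<Sum>k\<in>UNIV. ?d k r * (\<Sum>f\<in>A. \<Sum>g\<in>U. of_bool (dot k f = dot k g))) =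
       (\<Sum>k\<in>UNIV. \<Sum>f\<in>A. \<Sum>g\<in>U. ?d k r * of_bool (dot k (f - g) = 0))"
      by (simp only: sum_distrib_left dot_diff right_minus_eq)
    also have "\<dots> = (\<Sum>f\<in>A. \<Sum>g\<in>U. \<Sum>k\<in>UNIV. ?d k r * of_bool (dot k (f - g) = 0))"
      by (subst sum.swap, rule sum.cong[OF refl], rule sum.swap)
    also have "\<dots> = (\<Sum>f\<in>A. \<Sum>g\<in>U. ?q + (?q\<^sup>2 - ?q) * of_bool (parallel r (f - g)))"
      unfolding sum_of_bool_dot_direction by (intro sum.cong refl) simp
    also have "\<dots> = card A * card U * ?q + (?q\<^sup>2 - ?q) * (\<Sum>f\<in>A. \<Sum>g\<in>U. of_bool (parallel r (f - g)))"
      by (simp add: sum.distrib sum_distrib_left del: sum_of_bool_eq)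
    finally have *: "(\<Sum>k\<in>UNIV. ?d k r * (\<Sum>f\<in>A. \<Sum>g\<in>U. of_bool (dot k f = dot k g))) = \<dots>" .
    have "(\<Sum>k\<in>UNIV. ?d k r * (card A * card U / ?q)) = ?q\<^sup>2 * (card A * card U / ?q)"
      unfolding sum_distrib_right[symmetric] R ..
    also have "\<dots> = card A * card U * ?q" by (simp add: power2_eq_square)
    finally show "(\<Sum>k\<in>UNIV. ?d k r * excess A U k) =
        (?q\<^sup>2 - ?q) * (\<Sum>f\<in>A. \<Sum>g\<in>U. of_bool (parallel r (f - g)))"
      unfolding excess_def right_diff_distrib sum_subtractf * by simp
  qed
  finally show ?thesis unfolding sum_distrib_left .
qed

text \<open>The excess is a covariance, the inner product of centered fibre sizes; this makes
  Cauchy-Schwarz available.\<close>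

lemma excess_eq_sum:
  fixes A U :: "('a::{finite,field} \<times> 'a \<times> 'a) set"
  defines "fib \<equiv> \<lambda>(B :: ('a \<times> 'a \<times> 'a) set) k y. (\<Sum>f\<in>B. of_bool (dot k f = y)) - card B / CARD('a)"
  shows "excess A U k = (\<Sum>y\<in>UNIV. fib A k y * fib U k y)"
proof -
  let ?q = "real CARD('a)"
  define F :: "('a \<times> 'a \<times> 'a) set \<Rightarrow> 'a \<Rightarrow> real" where "F B y = (\<Sum>f\<in>B. of_bool (dot k f = y))" for B y
  have tot: "(\<Sum>y\<in>UNIV. F B y) = real (card B)" for B
    unfolding F_def by (subst sum.swap) simp
  have "(\<Sum>y\<in>UNIV. F A y * F U y) =
      (\<Sum>y\<in>UNIV. \<Sum>f\<in>A. \<Sum>g\<in>U. of_bool (dot k f = y) * of_bool (dot k g = y) :: real)"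
    unfolding F_def sum_product ..
  also have "\<dots> = (\<Sum>f\<in>A. \<Sum>g\<in>U. \<Sum>y\<in>UNIV. of_bool (dot k f = y) * of_bool (dot k g = y))"
    by (subst sum.swap, rule sum.cong[OF refl], rule sum.swap)
  also have "\<dots> = (\<Sum>f\<in>A. \<Sum>g\<in>U. of_bool (dot k f = dot k g))"
  proof (intro sum.cong refl)
    fix f g
    have "(\<Sum>y\<in>UNIV. of_bool (dot k f = y) * of_bool (dot k g = y)) =
        (\<Sum>y\<in>UNIV. if y = dot k f then of_bool (dot k g = dot k f) else (0::real))"
      by (intro sum.cong refl) auto
    then show "(\<Sum>y\<in>UNIV. of_bool (dot k f = y) * of_bool (dot k g = y)) = (of_bool (dot k f = dot k g) :: real)"
      by (auto simp: sum.delta)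
  qed
  finally have FF: "(\<Sum>y\<in>UNIV. F A y * F U y) = (\<Sum>f\<in>A. \<Sum>g\<in>U. of_bool (dot k f = dot k g))" .
  have "(\<Sum>y\<in>UNIV. fib A k y * fib U k y) =
      (\<Sum>y\<in>UNIV. F A y * F U y - card U / ?q * F A y - card A / ?q * F U y + card A * card U / ?q\<^sup>2)"
    unfolding fib_def F_def[symmetric] by (intro sum.cong refl) (simp add: power2_eq_square algebra_simps)
  also have "\<dots> = (\<Sum>y\<in>UNIV. F A y * F U y) - card U / ?q * card A - card A / ?q * card U
      + ?q * (card A * card U / ?q\<^sup>2)"
    unfolding sum.distrib sum_subtractf sum_distrib_left[symmetric] tot by simp
  finally show ?thesis unfolding FF excess_def by (simp add: power2_eq_square)
qed

lemma excess_self_nonneg: "excess A A k \<ge> 0"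
  unfolding excess_eq_sum by (intro sum_nonneg) (simp add: power2_eq_square[symmetric])

lemma excess_Cauchy_Schwarz:
  assumes "\<And>k. k \<in> K \<Longrightarrow> \<bar>e k\<bar> \<le> 1"
  shows "(\<Sum>k\<in>K. e k * excess A U k)\<^sup>2 \<le> (\<Sum>k\<in>K. excess A A k) * (\<Sum>k\<in>K. excess U U k)"
proof -
  define fib where "fib B k y = (\<Sum>f\<in>B. of_bool (dot k f = y)) - card B / CARD('a)"
    for B :: "('a \<times> 'a \<times> 'a) set" and k y
  have X: "excess B C k = (\<Sum>y\<in>UNIV. fib B k y * fib C k y)" for B C k
    unfolding fib_def by (rule excess_eq_sum)
  have "(\<Sum>k\<in>K. e k * excess A U k) = (\<Sum>(k, y)\<in>K \<times> UNIV. (e k * fib A k y) * fib U k y)"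
    unfolding X sum_distrib_left by (simp add: sum.cartesian_product mult.assoc)
  also have "\<dots>\<^sup>2 \<le> (\<Sum>(k, y)\<in>K \<times> UNIV. (e k * fib A k y)\<^sup>2) * (\<Sum>(k, y)\<in>K \<times> UNIV. (fib U k y)\<^sup>2)"
    using Cauchy_Schwarz_ineq_sum[of "\<lambda>(k, y). e k * fib A k y" "\<lambda>(k, y). fib U k y" "K \<times> UNIV"]
    by (simp add: split_def)
  also have "\<dots> \<le> (\<Sum>(k, y)\<in>K \<times> UNIV. (fib A k y)\<^sup>2) * (\<Sum>(k, y)\<in>K \<times> UNIV. (fib U k y)\<^sup>2)"
  proof (intro mult_right_mono sum_mono sum_nonneg)
    fix p :: "('a \<times> 'a \<times> 'a) \<times> 'a" assume p: "p \<in> K \<times> UNIV"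
    obtain k y where [simp]: "p = (k, y)" by (cases p)
    have "(e k)\<^sup>2 \<le> 1" using assms[of k] p by (simp add: abs_square_le_1)
    then show "(case p of (k, y) \<Rightarrow> (e k * fib A k y)\<^sup>2) \<le> (case p of (k, y) \<Rightarrow> (fib A k y)\<^sup>2)"
      by (simp add: power_mult_distrib mult_left_le_one_le)
  qed auto
  also have "\<dots> = (\<Sum>k\<in>K. excess A A k) * (\<Sum>k\<in>K. excess U U k)"
    by (simp add: X sum.cartesian_product power2_eq_square)
  finally show ?thesis .
qed

text \<open>The condition on \<open>r\<close> is a quadratic equation with coefficients
  \<open>w\<close>, \<open>- 2 * v\<close>, \<open>u\<close>, not all zero because 2 is
  invertible.\<close>

lemma roots_le_2:
  fixes k :: "'a::{finite,field} \<times> 'a \<times> 'a"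
  assumes "(2::'a) \<noteq> 0" "k \<noteq> 0"
  shows "roots k \<le> 2"
proof -
  obtain u v w where k: "k = (u, v, w)" by (metis prod_cases3)
  have "(w, - 2 * v, u) \<noteq> (0, 0, 0)" using assms by (auto simp: k zero_prod_def)
  then have "meets (w, - 2 * v, u) (0, 0, 0) \<le> 2" by (rule meets_le_2)
  moreover have "{r. ev (w, - 2 * v, u) r = ev (0, 0, 0) r} = {r. dot k (1, - 2 * r, r\<^sup>2) = 0}"
    by (auto simp: k algebra_simps)
  ultimately show ?thesis by (simp add: roots_def meets_def)
qed

lemma roots_cone:
  fixes l x :: "'a::{finite,field}"
  assumes "l \<noteq> 0"
  shows "roots (l * x\<^sup>2, l * x, l) = 1"
proof -
  have "dot (l * x\<^sup>2, l * x, l) (1, - 2 * r, r\<^sup>2) = l * (x - r)\<^sup>2" for r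
    by (simp add: power2_eq_square algebra_simps)
  then have "{r. dot (l * x\<^sup>2, l * x, l) (1, - 2 * r, r\<^sup>2) = 0} = {x}" using assms by auto
  then show ?thesis by (simp add: roots_def)
qed

text \<open>Agreement under a nonzero multiple of evaluation at \<open>x\<close> means meeting in
  column \<open>x\<close>, so summing over \<open>x\<close> gives \<open>meets\<close>. The factor
  \<open>q - 1\<close> counts the multiples.\<close>

lemma sum_excess_cone:
  fixes U :: "('a::{finite,field} \<times> 'a \<times> 'a) set"
  shows "(\<Sum>k\<in>(\<lambda>(l, x). (l * x\<^sup>2, l * x, l)) ` ((-{0}) \<times> UNIV). excess U U k) =
    (real CARD('a) - 1) * ((\<Sum>f\<in>U. \<Sum>g\<in>U. real (meets f g)) - (real (card U))\<^sup>2)"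
proof -
  let ?c = "\<lambda>(l :: 'a, x). (l * x\<^sup>2, l * x, l)"
  have inj: "inj_on ?c ((-{0}) \<times> UNIV)" by (auto simp: inj_on_def)
  have "(\<Sum>k\<in>?c ` ((-{0}) \<times> UNIV). excess U U k) = (\<Sum>(l, x)\<in>(-{0}) \<times> UNIV. excess U U (l * x\<^sup>2, l * x, l))"
    by (subst sum.reindex[OF inj]) (simp add: split_def)
  also have "\<dots> = (\<Sum>l\<in>-{0}. \<Sum>x\<in>UNIV. excess U U (l * x\<^sup>2, l * x, l))"
    by (rule sum.cartesian_product[symmetric])
  also have "\<dots> = (\<Sum>l\<in>-{0::'a}. (\<Sum>f\<in>U. \<Sum>g\<in>U. real (meets f g)) - (real (card U))\<^sup>2)"
  proof (rule sum.cong[OF refl])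
    fix l :: 'a assume "l \<in> -{0}"
    then have "(\<Sum>x\<in>UNIV. \<Sum>f\<in>U. \<Sum>g\<in>U. of_bool (dot (l * x\<^sup>2, l * x, l) f = dot (l * x\<^sup>2, l * x, l) g)) =
      (\<Sum>x\<in>UNIV. \<Sum>f\<in>U. \<Sum>g\<in>U. of_bool (ev f x = ev g x) :: real)"
      by (simp add: dot_cone)
    also have "\<dots> = (\<Sum>f\<in>U. \<Sum>g\<in>U. real (meets f g))"
      unfolding meets_eq_sum by (subst sum.swap, rule sum.cong[OF refl], rule sum.swap)
    finally show "(\<Sum>x\<in>UNIV. excess U U (l * x\<^sup>2, l * x, l)) =
        (\<Sum>f\<in>U. \<Sum>g\<in>U. real (meets f g)) - (real (card U))\<^sup>2"
      unfolding excess_def sum_subtractf by (simp add: power2_eq_square)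
  qed
  finally show ?thesis by (simp add: card_Compl_singleton)
qed

text \<open>A functional \<open>k \<noteq> 0\<close> vanishes on at most two of the directions \<open>(1, -2r, r\<^sup>2)\<close>, and on exactly
  one if it is a multiple of an evaluation map. So the weighted sum of the excesses with weight
  \<open>roots k - 1\<close> only involves functionals on which the excess of \<open>U\<close> is small.\<close>

lemma parallel_pairs_bound:
  fixes A U :: "('a::{finite,field} \<times> 'a \<times> 'a) set"
  assumes two: "(2::'a) \<noteq> 0" and AU: "A \<subseteq> U"
  defines "q \<equiv> real CARD('a)" and "n \<equiv> real (card A)" and "u \<equiv> real (card U)"
  defines "D \<equiv> q\<^sup>2 * u + u\<^sup>2 - u\<^sup>2 / q - (\<Sum>f\<in>U. \<Sum>g\<in>U. real (meets f g))"
    and "N \<equiv> (\<Sum>r\<in>UNIV. \<Sum>f\<in>A. \<Sum>g\<in>U. of_bool (parallel r (f - g))) - q * n - n * u * (q - 1) / q\<^sup>2"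
  shows "N\<^sup>2 \<le> n * D" "A = U \<Longrightarrow> N \<le> D / q"
proof -
  define cone where "cone = (\<lambda>(l :: 'a, x). (l * x\<^sup>2, l * x, l)) ` ((-{0}) \<times> UNIV)"
  define K where "K = - insert 0 cone"
  have q: "q > 1"
    unfolding q_def using card_mono[of UNIV "{0, 1 :: 'a}"] by simp
  have cone0: "0 \<notin> cone" by (auto simp: cone_def zero_prod_def)
  have split: "(\<Sum>k\<in>UNIV. F k) = F 0 + (\<Sum>k\<in>cone. F k) + (\<Sum>k\<in>K. F k)" for F :: "'a \<times> 'a \<times> 'a \<Rightarrow> real"
  proof -
    have "(\<Sum>k\<in>UNIV. F k) = (\<Sum>k\<in>insert 0 cone. F k) + (\<Sum>k\<in>K. F k)"
      unfolding K_def by (subst sum.union_disjoint[symmetric]) auto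
    then show ?thesis using cone0 by simp
  qed
  have ex0: "excess B C 0 = real (card B) * real (card C) - real (card B) * real (card C) / q" for B C :: "('a \<times> 'a \<times> 'a) set"
    by (simp add: excess_def q_def)
  have roots0: "roots (0 :: 'a \<times> 'a \<times> 'a) = q" by (simp add: roots_def q_def)
  have "roots k = 1" if "k \<in> cone" for k
    using that roots_cone unfolding cone_def by auto
  then have "(\<Sum>k\<in>cone. (roots k - 1) * excess A U k) = 0" by (intro sum.neutral) simp
  \<comment> \<open>The zero functional has all \<open>q\<close> directions as roots and so weight
    \<open>q - 1\<close>; its contribution becomes the term
    \<open>n * u * (q - 1) / q\<^sup>2\<close> in \<open>N\<close>.\<close>
  then have X1: "(\<Sum>k\<in>UNIV. (roots k - 1) * excess A U k) =
      (q - 1) * excess A U 0 + (\<Sum>k\<in>K. (roots k - 1) * excess A U k)"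
    unfolding split roots0 by simp
  have X2: "(\<Sum>k\<in>UNIV. (roots k - 1) * excess A U k) =
      (q\<^sup>2 - q) * (\<Sum>r\<in>UNIV. \<Sum>f\<in>A. \<Sum>g\<in>U. of_bool (parallel r (f - g))) - (q^3 - q\<^sup>2) * n"
    unfolding left_diff_distrib sum_subtractf sum_roots_excess by (simp add: sum_excess[OF AU] q_def n_def algebra_simps)
  have X3: "(q\<^sup>2 - q) * W - (q^3 - q\<^sup>2) * n - (q - 1) * (n * u - n * u / q) =
      q * (q - 1) * (W - q * n - n * u * (q - 1) / q\<^sup>2)" for W
    using q by (simp add: field_simps power2_eq_square power3_eq_cube)
  have X: "(\<Sum>k\<in>K. (roots k - 1) * excess A U k) = q * (q - 1) * N"
    unfolding N_def X3[symmetric] using X1 X2 unfolding ex0 n_def[symmetric] u_def[symmetric] by linarith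
  have offA: "(\<Sum>k\<in>K. excess A A k) \<le> (q - 1) * q\<^sup>2 * n"
  proof -
    have "0 \<le> (\<Sum>k\<in>cone. excess A A k)" by (intro sum_nonneg excess_self_nonneg)
    moreover have "0 \<le> excess A A 0" by (rule excess_self_nonneg)
    ultimately have "(\<Sum>k\<in>K. excess A A k) \<le> (\<Sum>k\<in>UNIV. excess A A k)" unfolding split by linarith
    also have "\<dots> = (q - 1) * q\<^sup>2 * n"
      by (simp add: sum_excess q_def n_def power2_eq_square power3_eq_cube algebra_simps)
    finally show ?thesis .
  qed
  \<comment> \<open>For \<open>U\<close> the sum is computed exactly. Pairs that meet twice
    concentrate the excess of \<open>U\<close> on the cone, so the remainder \<open>D\<close> is
    small when \<open>U\<close> is large and mostly free of tangencies.\<close>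
  have offU: "(\<Sum>k\<in>K. excess U U k) = (q - 1) * D"
  proof -
    have "(\<Sum>k\<in>K. excess U U k) = (\<Sum>k\<in>UNIV. excess U U k) - excess U U 0 - (\<Sum>k\<in>cone. excess U U k)"
      unfolding split by simp
    also have "\<dots> = (q^3 - q\<^sup>2) * u - (u * u - u * u / q) - (q - 1) * ((\<Sum>f\<in>U. \<Sum>g\<in>U. real (meets f g)) - u\<^sup>2)"
      unfolding cone_def sum_excess_cone ex0 by (simp add: sum_excess q_def u_def)
    also have "(q^3 - q\<^sup>2) * u - (u * u - u * u / q) - (q - 1) * (S - u\<^sup>2) =
        (q - 1) * (q\<^sup>2 * u + u\<^sup>2 - u\<^sup>2 / q - S)" for S
      using q by (simp add: field_simps power2_eq_square power3_eq_cube)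
    finally show ?thesis unfolding D_def .
  qed
  have e: "\<bar>roots k - 1\<bar> \<le> 1" if "k \<in> K" for k
  proof -
    have "k \<noteq> 0" using that by (auto simp: K_def)
    moreover have "roots k \<ge> 0" by (simp add: roots_def sum_nonneg)
    ultimately show ?thesis using roots_le_2[OF two] by fastforce
  qed
  have D: "(q - 1) * D \<ge> 0" unfolding offU[symmetric] by (intro sum_nonneg excess_self_nonneg)
  have CS: "(q * (q - 1) * N)\<^sup>2 \<le> (\<Sum>k\<in>K. excess A A k) * ((q - 1) * D)"
    using excess_Cauchy_Schwarz[where K = K and e = "\<lambda>k. roots k - 1" and A = A and U = U] e
    unfolding X offU by blast
  also have "\<dots> \<le> (q - 1) * q\<^sup>2 * n * ((q - 1) * D)"
    by (rule mult_right_mono[OF offA D])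
  finally have "(q * (q - 1))\<^sup>2 * N\<^sup>2 \<le> (q * (q - 1))\<^sup>2 * (n * D)"
    by (simp add: power2_eq_square mult_ac)
  then show "N\<^sup>2 \<le> n * D" using q by (simp add: mult_le_cancel_left_pos)
  \<comment> \<open>Here both Cauchy-Schwarz factors are the exact sum for \<open>U\<close>, so the
    cruder bound \<open>offA\<close> is avoided.\<close>
  show "N \<le> D / q" if "A = U"
  proof -
    have "(q * (q - 1) * N)\<^sup>2 \<le> ((q - 1) * D)\<^sup>2"
      using CS unfolding that offU by (simp add: power2_eq_square)
    then have "q * (q - 1) * N \<le> (q - 1) * D"
      using D by (rule power2_le_imp_le)
    then have "q * N \<le> D" using q by (simp add: mult.assoc mult.left_commute)
    then show ?thesis using q by (simp add: field_simps)
  qed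
qed

subsection \<open>Finite fields of even order and numerical estimates\<close>

lemma even_card_involution:
  fixes h :: "'b \<Rightarrow> 'b"
  assumes "finite A" "\<And>x. x \<in> A \<Longrightarrow> h x \<in> A \<and> h x \<noteq> x \<and> h (h x) = x"
  shows "even (card A)"
  using assms
proof (induction A rule: finite_psubset_induct)
  case (psubset A)
  show ?case
  proof (cases "A = {}")
    case False
    then obtain x where x: "x \<in> A" by auto
    let ?A = "A - {x, h x}"
    have *: "h y \<in> ?A \<and> h y \<noteq> y \<and> h (h y) = y" if "y \<in> ?A" for y
      using psubset.prems x that by (metis Diff_iff insert_iff singletonD)
    have hx: "h x \<in> A" "h x \<noteq> x" using psubset.prems x by auto
    have "even (card ?A)" by (rule psubset.IH) (use x * in auto)
    moreover have "card ?A = card A - 2"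
      using hx x by (simp add: card_Diff_subset)
    moreover have "card A \<ge> card {x, h x}" using hx x psubset.hyps by (intro card_mono) auto
    ultimately show ?thesis using hx by simp
  qed simp
qed

text \<open>Adding 1 is a fixed-point-free involution if \<open>2 = 0\<close>; otherwise negation is
  one on the nonzero elements, which makes the order odd.\<close>

lemma two_eq_0_iff_even_card:
  "(2 :: 'a::{finite,field}) = 0 \<longleftrightarrow> even CARD('a)"
proof
  assume two: "(2 :: 'a) = 0"
  show "even CARD('a)"
  proof (rule even_card_involution[where h = "\<lambda>x. x + 1"])
    fix x :: 'a
    have "x + 1 + 1 = x + 2" by simp
    then show "x + 1 \<in> UNIV \<and> x + 1 \<noteq> x \<and> x + 1 + 1 = x" unfolding two by simp
  qed simp
next
  assume even: "even CARD('a)"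
  show "(2 :: 'a) = 0"
  proof (rule ccontr)
    assume two: "(2 :: 'a) \<noteq> 0"
    have "- x \<noteq> x" if "x \<noteq> 0" for x :: 'a
    proof
      assume "- x = x"
      then have "x + x = 0" by (metis add.right_inverse)
      then have "2 * x = 0" by (simp only: mult_2)
      then show False using two that by simp
    qed
    then have "even (card (- {0 :: 'a}))"
      by (intro even_card_involution[where h = uminus]) auto
    then show False using even by (simp add: Compl_eq_Diff_UNIV card_Diff_singleton)
  qed
qed

text \<open>Excludes order 6 without the prime power theorem: the additive subgroup
  \<open>{0, 1, w, 1 + w}\<close> has a disjoint translate.\<close>

lemma even_card_field_ge_8:
  assumes "(2 :: 'a::{finite,field}) = 0" "CARD('a) > 4"
  shows "CARD('a) \<ge> 8"
proof -
  have d: "x + x = 0" for x :: 'a using assms(1) by (metis mult_2 mult_zero_left)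
  have d': "x + (x + y) = y" for x y :: 'a by (simp add: add.assoc[symmetric] d)
  have "card {0, 1 :: 'a} < CARD('a)" using assms(2) by simp
  then obtain w where w: "w \<notin> {0, 1 :: 'a}" by (metis UNIV_eq_I nat_less_le)
  define S where "S = {0, 1, w, 1 + w}"
  have cS: "card S = 4"
  proof -
    have "1 + w \<noteq> 0" using w d' d by (metis add.right_neutral insertI1 insertI2)
    then show ?thesis using w by (auto simp: S_def)
  qed
  then have "S \<noteq> UNIV" using assms(2) by auto
  then obtain z where z: "z \<notin> S" by auto
  have closed: "a + b \<in> S" if "a \<in> S" "b \<in> S" for a b
    using that unfolding S_def by (auto simp: d d' add_ac)
  have "S \<inter> (\<lambda>a. a + z) ` S = {}"
  proof -
    have "z \<in> S" if "a \<in> S" "a + z \<in> S" for a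
      using closed[OF that] d' by simp
    then show ?thesis using z by auto
  qed
  moreover have "card ((\<lambda>a. a + z) ` S) = 4" using cS by (simp add: card_image)
  moreover have "finite S" by (simp add: S_def)
  ultimately have "card (S \<union> (\<lambda>a. a + z) ` S) = 8" using cS by (simp add: card_Un_disjoint)
  then show ?thesis using card_mono[of UNIV "S \<union> (\<lambda>a. a + z) ` S"] by simp
qed

section \<open>Real inequalities ruling out stars of intermediate size\<close>

lemma concave_quadratic_pos:
  fixes \<alpha> \<kappa> \<gamma> x l h :: real
  assumes "\<kappa> \<ge> 0" "l \<le> x" "x \<le> h"
    and "\<alpha> * l - \<kappa> * l\<^sup>2 - \<gamma> > 0" "\<alpha> * h - \<kappa> * h\<^sup>2 - \<gamma> > 0"
  shows "\<alpha> * x - \<kappa> * x\<^sup>2 - \<gamma> > 0"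
\<comment> \<open>The value at \<open>x\<close> minus that at \<open>l\<close> is
  \<open>(x - l) * (\<alpha> - \<kappa> * (x + l))\<close>. If this factor is negative, the
  analogous difference with \<open>h\<close> is nonnegative.\<close>
proof (cases "\<alpha> \<ge> \<kappa> * (x + l)")
  case True
  then have "(x - l) * (\<alpha> - \<kappa> * (x + l)) \<ge> 0" using assms by simp
  then show ?thesis using assms(4) by (simp add: algebra_simps power2_eq_square)
next
  case False
  have "\<kappa> * l \<le> \<kappa> * h" using assms by (intro mult_left_mono) auto
  then have "\<kappa> * (x + h) \<ge> \<alpha>" using False by (simp add: distrib_left)
  then have "(h - x) * (\<kappa> * (x + h) - \<alpha>) \<ge> 0" using assms by simp
  then show ?thesis using assms(5) by (simp add: algebra_simps power2_eq_square)
qed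

text \<open>The square is linearised by \<open>w\<^sup>2 \<ge> 2 \<mu> B w - \<mu>\<^sup>2 B\<^sup>2\<close> with \<open>\<mu> = 3/4\<close>.\<close>

lemma linearised_inequality:
  fixes q n B T \<theta> :: real
  assumes "0 < n" "0 < B" "T \<le> n * \<theta>" "\<theta> \<le> B * (1 + 1 / q)"
    and "(B * (n * (1 + 1 / q)) - T)\<^sup>2 \<le> B * ((q - 1) * (n * (q\<^sup>2 - n)))"
  shows "n * (3/2 * (B * (1 + 1 / q) - \<theta>) - 9/16 * B) \<le> (q - 1) * (q\<^sup>2 - n)"
proof -
  define w where "w = B * (1 + 1 / q) - \<theta>"
  have w: "w \<ge> 0" using assms by (simp add: w_def)
  have "n * w \<le> B * (n * (1 + 1 / q)) - T"
    using assms(3) by (simp add: w_def algebra_simps)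
  then have "(n * w)\<^sup>2 \<le> (B * (n * (1 + 1 / q)) - T)\<^sup>2"
    using w assms(1) by (intro power_mono) auto
  then have "(n * w)\<^sup>2 \<le> B * ((q - 1) * (n * (q\<^sup>2 - n)))" using assms(5) by linarith
  then have "n * (n * w\<^sup>2) \<le> n * (B * ((q - 1) * (q\<^sup>2 - n)))"
    by (simp add: power2_eq_square mult_ac)
  then have 1: "n * w\<^sup>2 \<le> B * ((q - 1) * (q\<^sup>2 - n))" using assms(1) by simp
  have "(w - 3/4 * B)\<^sup>2 \<ge> 0" by simp
  then have "B * (3/2 * w - 9/16 * B) \<le> w\<^sup>2" by (simp add: power2_eq_square algebra_simps)
  then have "n * (B * (3/2 * w - 9/16 * B)) \<le> n * w\<^sup>2" using assms(1) by (intro mult_left_mono) auto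
  with 1 have "B * (n * (3/2 * w - 9/16 * B)) \<le> B * ((q - 1) * (q\<^sup>2 - n))"
    by (simp add: mult_ac)
  then show ?thesis using assms(2) by (simp add: w_def)
qed

text \<open>The constants \<open>24/25\<close> and \<open>932/1000\<close> are lower bounds for the threshold of the theorem divided by
  \<open>q\<^sup>2\<close>, for \<open>q \<ge> 11\<close> and \<open>q \<ge> 8\<close>; the term \<open>47/1000 * q\<^sup>2\<close> absorbs the error in the count of
  tangent pairs.\<close>

lemma no_large_star_odd:
  fixes q n u T :: real
  assumes q: "q \<ge> 11" and u: "u \<ge> 24/25 * q\<^sup>2" and n: "n \<ge> 182/100 * q" "n \<le> (q - 1) * (q + 2) / 2"
    and T: "T \<le> n * (2 * (q - 1) + 47/1000 * q\<^sup>2)"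
    and ineq: "((u - n) * (n * (1 + 1 / q)) - T)\<^sup>2 \<le> (u - n) * ((q - 1) * (n * (q\<^sup>2 - n)))"
  shows False
proof -
  define B where "B = u - n"
  define t where "t = q - 11"
  have t: "t \<ge> 0" "q = 11 + t" using q by (simp_all add: t_def)
  have B: "B \<ge> 24/25 * q\<^sup>2 - n" using u by (simp add: B_def)
  have th: "2 * (q - 1) + 47/1000 * q\<^sup>2 \<le> 24/25 * q\<^sup>2 - (q - 1) * (q + 2) / 2"
    using t(1) unfolding t(2) by (simp add: field_simps power2_eq_square)
  have "2 * (q - 1) + 47/1000 * q\<^sup>2 > 0" using q by (intro add_pos_nonneg) auto
  then have Bth: "B \<ge> 2 * (q - 1) + 47/1000 * q\<^sup>2" and B0: "B > 0" using B n(2) th by linarith+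
  have "B \<le> B * (1 + 1 / q)" using B0 q by (simp add: distrib_left)
  then have th': "2 * (q - 1) + 47/1000 * q\<^sup>2 \<le> B * (1 + 1 / q)" using Bth by linarith
  have sq: "11 * q \<le> q\<^sup>2" and cu: "11 * q\<^sup>2 \<le> q^3"
    using q by (simp_all add: power2_eq_square power3_eq_cube)
  have n0: "n > 0" using n q by linarith
  have "n * (3/2 * (B * (1 + 1 / q) - (2 * (q - 1) + 47/1000 * q\<^sup>2)) - 9/16 * B) \<le> (q - 1) * (q\<^sup>2 - n)"
    using linearised_inequality[OF n0 B0 T th'] ineq unfolding B_def by blast
  moreover have "3/2 * (B * (1 + 1 / q) - (2 * (q - 1) + 47/1000 * q\<^sup>2)) - 9/16 * B \<ge>
      (8295/10000 * q\<^sup>2 - 156/100 * q + 3) - 27/25 * n"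
  proof -
    define X Y Z where "X = B * (15/16 + 3/2 / q)" and "Y = n * (15/16 + 3/2 / q)" and "Z = B * (1 + 1 / q)"
    have "(24/25 * q\<^sup>2 - n) * (15/16 + 3/2 / q) \<le> X"
      unfolding X_def using B q by (intro mult_right_mono) auto
    moreover have "(24/25 * q\<^sup>2 - n) * (15/16 + 3/2 / q) = 9/10 * q\<^sup>2 + 144/100 * q - Y"
      unfolding Y_def using q by (simp add: field_simps power2_eq_square)
    \<comment> \<open>\<open>15/16 = 3/2 - 9/16\<close>, and \<open>15/16 + 3/2 / q\<close> stays
      below \<open>27/25\<close> from \<open>q = 11\<close> on.\<close>
    moreover have "Y \<le> 27/25 * n"
      unfolding Y_def using n0 q by (simp add: field_simps)
    moreover have "3/2 * Z - 9/16 * B = X"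
      by (simp add: X_def Z_def algebra_simps)
    ultimately show ?thesis unfolding Z_def[symmetric] by (simp add: field_simps)
  qed
  then have "n * (3/2 * (B * (1 + 1 / q) - (2 * (q - 1) + 47/1000 * q\<^sup>2)) - 9/16 * B) \<ge>
      n * ((8295/10000 * q\<^sup>2 - 156/100 * q + 3) - 27/25 * n)"
    using n0 by (intro mult_left_mono) auto
  ultimately have "(8295/10000 * q\<^sup>2 - 56/100 * q + 2) * n - 27/25 * n\<^sup>2 - (q - 1) * q\<^sup>2 \<le> 0"
    by (simp add: algebra_simps power2_eq_square)
  moreover have "(8295/10000 * q\<^sup>2 - 56/100 * q + 2) * n - 27/25 * n\<^sup>2 - (q - 1) * q\<^sup>2 > 0"
  \<comment> \<open>The endpoints are the rich-point lower bound for \<open>n\<close> and the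
    largest star that an outside polynomial can meet completely.\<close>
  proof (rule concave_quadratic_pos[OF _ n])
    have "0 < q * (50969/100000 * q\<^sup>2 - 3596592/1000000 * q + 364/100)"
      using q sq by (intro mult_pos_pos) linarith+
    then show "(8295/10000 * q\<^sup>2 - 56/100 * q + 2) * (182/100 * q) - 27/25 * (182/100 * q)\<^sup>2 - (q - 1) * q\<^sup>2 > 0"
      by (simp add: power2_eq_square algebra_simps)
    have "0 < 2895/10000 * q^3 - 2521/1000 * q\<^sup>2 + 88/100 * q + 616/100"
      using q sq cu by linarith
    then have "0 < (q - 1) / 2 * (2895/10000 * q^3 - 2521/1000 * q\<^sup>2 + 88/100 * q + 616/100)"
      using q by (intro mult_pos_pos) simp_all
    then show "(8295/10000 * q\<^sup>2 - 56/100 * q + 2) * ((q - 1) * (q + 2) / 2) - 27/25 * ((q - 1) * (q + 2) / 2)\<^sup>2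
        - (q - 1) * q\<^sup>2 > 0"
      by (simp add: field_simps power2_eq_square power3_eq_cube)
  qed simp
  ultimately show False by linarith
qed

text \<open>The scheme of the odd case without an error term, since in characteristic 2 tangencies
  are bounded outright by \<open>2 * (q - 1)\<close> per member.\<close>

lemma no_large_star_even:
  fixes q n u T :: real
  assumes q: "q \<ge> 8" and u: "u \<ge> 932/1000 * q\<^sup>2" and n: "n \<ge> 1739/1000 * q" "n \<le> (q - 1) * (q + 2) / 2"
    and T: "T \<le> n * (2 * (q - 1))"
    and ineq: "((u - n) * (n * (1 + 1 / q)) - T)\<^sup>2 \<le> (u - n) * ((q - 1) * (n * (q\<^sup>2 - n)))"
  shows False
proof -
  define B where "B = u - n"
  define t where "t = q - 8"
  have t: "t \<ge> 0" "q = 8 + t" using q by (simp_all add: t_def)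
  have B: "B \<ge> 932/1000 * q\<^sup>2 - n" using u by (simp add: B_def)
  have th: "2 * (q - 1) \<le> 932/1000 * q\<^sup>2 - (q - 1) * (q + 2) / 2"
    using t(1) unfolding t(2) by (simp add: field_simps power2_eq_square)
  then have Bth: "B \<ge> 2 * (q - 1)" using B n(2) by linarith
  then have B0: "B > 0" using q by simp
  have "B \<le> B * (1 + 1 / q)" using B0 q by (simp add: distrib_left)
  then have th': "2 * (q - 1) \<le> B * (1 + 1 / q)" using Bth by linarith
  have sq: "8 * q \<le> q\<^sup>2" and cu: "8 * q\<^sup>2 \<le> q^3"
    using q by (simp_all add: power2_eq_square power3_eq_cube)
  \<comment> \<open>A bound for \<open>q^3\<close> sharp to second order at \<open>q = 8\<close>;
    \<open>8 * q\<^sup>2 \<le> q^3\<close> alone would leave a negative leading coefficient at the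
    right endpoint.\<close>
  have "0 \<le> (q - 8) * (q * (q - 8))" using q by simp
  then have cu': "16 * q\<^sup>2 - 64 * q \<le> q^3"
    by (simp add: power2_eq_square power3_eq_cube algebra_simps)
  have n0: "n > 0" using n q by linarith
  have "n * (3/2 * (B * (1 + 1 / q) - 2 * (q - 1)) - 9/16 * B) \<le> (q - 1) * (q\<^sup>2 - n)"
    using linearised_inequality[OF n0 B0 T th'] ineq unfolding B_def by blast
  moreover have "3/2 * (B * (1 + 1 / q) - 2 * (q - 1)) - 9/16 * B \<ge>
      (87375/100000 * q\<^sup>2 - 1602/1000 * q + 3) - 9/8 * n"
  proof -
    define X Y Z where "X = B * (15/16 + 3/2 / q)" and "Y = n * (15/16 + 3/2 / q)" and "Z = B * (1 + 1 / q)"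
    have "(932/1000 * q\<^sup>2 - n) * (15/16 + 3/2 / q) \<le> X"
      unfolding X_def using B q by (intro mult_right_mono) auto
    moreover have "(932/1000 * q\<^sup>2 - n) * (15/16 + 3/2 / q) = 87375/100000 * q\<^sup>2 + 1398/1000 * q - Y"
      unfolding Y_def using q by (simp add: field_simps power2_eq_square)
    moreover have "Y \<le> 9/8 * n"
      unfolding Y_def using n0 q by (simp add: field_simps)
    moreover have "3/2 * Z - 9/16 * B = X"
      by (simp add: X_def Z_def algebra_simps)
    ultimately show ?thesis unfolding Z_def[symmetric] by (simp add: field_simps)
  qed
  then have "n * (3/2 * (B * (1 + 1 / q) - 2 * (q - 1)) - 9/16 * B) \<ge>
      n * ((87375/100000 * q\<^sup>2 - 1602/1000 * q + 3) - 9/8 * n)"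
    using n0 by (intro mult_left_mono) auto
  ultimately have "(87375/100000 * q\<^sup>2 - 602/1000 * q + 2) * n - 9/8 * n\<^sup>2 - (q - 1) * q\<^sup>2 \<le> 0"
    by (simp add: algebra_simps power2_eq_square)
  moreover have "(87375/100000 * q\<^sup>2 - 602/1000 * q + 2) * n - 9/8 * n\<^sup>2 - (q - 1) * q\<^sup>2 > 0"
  proof (rule concave_quadratic_pos[OF _ n])
    have "0 < q * (51945125/100000000 * q\<^sup>2 - 3449014125/1000000000 * q + 3478/1000)"
      using q sq by (intro mult_pos_pos) linarith+
    then show "(87375/100000 * q\<^sup>2 - 602/1000 * q + 2) * (1739/1000 * q) - 9/8 * (1739/1000 * q)\<^sup>2 - (q - 1) * q\<^sup>2 > 0"
      by (simp add: power2_eq_square algebra_simps)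
    have "0 < 31125/100000 * q^3 - 2542/1000 * q\<^sup>2 + 796/1000 * q + 625/100"
      using q sq cu cu' by linarith
    then have "0 < (q - 1) / 2 * (31125/100000 * q^3 - 2542/1000 * q\<^sup>2 + 796/1000 * q + 625/100)"
      using q by (intro mult_pos_pos) simp_all
    then show "(87375/100000 * q\<^sup>2 - 602/1000 * q + 2) * ((q - 1) * (q + 2) / 2) - 9/8 * ((q - 1) * (q + 2) / 2)\<^sup>2
        - (q - 1) * q\<^sup>2 > 0"
      by (simp add: field_simps power2_eq_square power3_eq_cube)
  qed simp
  ultimately show False by linarith
qed

lemma threshold_odd:
  fixes q :: real
  assumes "q \<ge> 11"
  shows "24/25 * q\<^sup>2 \<le> q\<^sup>2 - q * sqrt q / 4 + 3 * q / 8 + sqrt q / 8"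
proof -
  define r where "r = sqrt q"
  have q: "q = r\<^sup>2" and r: "r \<ge> 0" using assms by (simp_all add: r_def)
  have "r * (1/25 * r^3 - r\<^sup>2 / 4 + 3 * r / 8 + 1 / 8) \<ge> 0"
  proof (rule mult_nonneg_nonneg[OF r])
    \<comment> \<open>12500 times the cubic exceeds this product by \<open>47.5 * r + 794.5\<close>;
      the double root 16/5 is close to the local minimum of the cubic.\<close>
    have "(5 * r - 16)\<^sup>2 * (20 * r + 3) \<ge> 0" using r by simp
    moreover have "(5 * r - 16)\<^sup>2 * (20 * r + 3) = 500 * r^3 - 3125 * r\<^sup>2 + 4640 * r + 768"
      by (simp add: power2_eq_square power3_eq_cube algebra_simps)
    ultimately show "1/25 * r^3 - r\<^sup>2 / 4 + 3 * r / 8 + 1 / 8 \<ge> 0" using r by linarith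
  qed
  then show ?thesis unfolding r_def[symmetric] unfolding q
    by (simp add: power2_eq_square power3_eq_cube algebra_simps)
qed

lemma threshold_even:
  fixes q :: real
  assumes "q \<ge> 8"
  shows "932/1000 * q\<^sup>2 \<le> q\<^sup>2 - q * sqrt q / 4 + q / 8 + sqrt q / 8"
proof -
  define r where "r = sqrt q"
  have q: "q = r\<^sup>2" using assms by (simp add: r_def)
  have r: "r \<ge> 282/100"
    unfolding r_def using assms by (intro real_le_rsqrt) (simp add: power2_eq_square)
  \<comment> \<open>282/100 lies just below the square root of 8; expanded around it, the cubic has
    only positive coefficients.\<close>
  define t where "t = r - 282/100"
  have t: "t \<ge> 0" "r = 282/100 + t" using r by (simp_all add: t_def)
  have "r * (68/1000 * r^3 - r\<^sup>2 / 4 + r / 8 + 1 / 8) \<ge> 0"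
  proof (rule mult_nonneg_nonneg)
    show "68/1000 * r^3 - r\<^sup>2 / 4 + r / 8 + 1 / 8 \<ge> 0"
      using t(1) unfolding t(2) by (simp add: power2_eq_square power3_eq_cube field_simps)
  qed (use r in simp)
  then show ?thesis unfolding r_def[symmetric] unfolding q
    by (simp add: power2_eq_square power3_eq_cube algebra_simps)
qed

subsection \<open>Pairwise meeting families\<close>

lemma meets_same_coeffs:
  assumes "meets (a, b, c) (a, b, c') > 0"
  shows "c = c'"
  using assms by (auto simp: meets_def card_gt_0_iff)

text \<open>Members with equal first two coefficients differ by a constant, so they meet only if
  they are equal.\<close>

lemma card_pairwise_meeting_le:
  fixes U :: "('a::{finite,field} \<times> 'a \<times> 'a) set"
  assumes "\<forall>f\<in>U. \<forall>g\<in>U. meets f g > 0"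
  shows "real (card U) \<le> (real CARD('a))\<^sup>2"
proof -
  have "c = c'" if "(a, b, c) \<in> U" "(a, b, c') \<in> U" for a b c c'
    using assms that meets_same_coeffs by blast
  then have "inj_on (\<lambda>(a, b, c). (a, b)) U" by (auto simp: inj_on_def)
  then have "card U \<le> CARD('a \<times> 'a)" by (rule card_inj_on_le) auto
  then have "real (card U) \<le> real (CARD('a) * CARD('a))" by (subst of_nat_le_iff) simp
  then show ?thesis by (simp add: power2_eq_square)
qed

lemma card_same_coeff_le:
  fixes U :: "('a::{finite,field} \<times> 'a \<times> 'a) set"
  assumes "\<forall>f\<in>U. \<forall>g\<in>U. meets f g > 0"
  shows "(\<Sum>g\<in>U. of_bool (fst f = fst g)) \<le> real CARD('a)"
    and "(\<Sum>g\<in>U. of_bool (fst (snd f) = fst (snd g))) \<le> real CARD('a)"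
proof -
  have same: "c = c'" if "(a, b, c) \<in> U" "(a, b, c') \<in> U" for a b c c'
    using assms that meets_same_coeffs by blast
  have "inj_on (\<lambda>g. fst (snd g)) {g \<in> U. fst f = fst g}"
    by (auto simp: inj_on_def dest: same)
  then have "card {g \<in> U. fst f = fst g} \<le> CARD('a)" by (rule card_inj_on_le) auto
  then show "(\<Sum>g\<in>U. of_bool (fst f = fst g)) \<le> real CARD('a)" by (simp add: Int_def)
  have "inj_on fst {g \<in> U. fst (snd f) = fst (snd g)}"
    by (auto simp: inj_on_def dest: same)
  then have "card {g \<in> U. fst (snd f) = fst (snd g)} \<le> CARD('a)" by (rule card_inj_on_le) auto
  then show "(\<Sum>g\<in>U. of_bool (fst (snd f) = fst (snd g))) \<le> real CARD('a)" by (simp add: Int_def)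
qed

lemma sum_meets_pairwise_meeting:
  fixes U :: "('a::{finite,field} \<times> 'a \<times> 'a) set"
  assumes "\<forall>f\<in>U. \<forall>g\<in>U. meets f g > 0"
  shows "(\<Sum>f\<in>U. \<Sum>g\<in>U. real (meets f g)) =
    (real CARD('a) - 2) * card U + 2 * (real (card U))\<^sup>2 - tangents U U"
proof -
  have q: "CARD('a) \<ge> 2" using card_mono[of UNIV "{0, 1 :: 'a}"] by simp
  have "(\<Sum>f\<in>U. \<Sum>g\<in>U. real (meets f g)) =
      (\<Sum>f\<in>U. \<Sum>g\<in>U. (if f = g then real CARD('a) - 2 else 0) + 2 - of_bool (meets f g = 1))"
  proof (intro sum.cong refl)
    fix f g assume "f \<in> U" "g \<in> U"
    then have "meets f g > 0" using assms by blast
    then have "meets f g = 1 \<or> meets f g = 2" if "f \<noteq> g"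
      using meets_le_2[OF that] by linarith
    then show "real (meets f g) = (if f = g then real CARD('a) - 2 else 0) + 2 - of_bool (meets f g = 1)"
      using q by (cases "f = g") auto
  qed
  also have "\<dots> = (real CARD('a) - 2) * card U + 2 * (real (card U))\<^sup>2 - tangents U U"
    by (simp add: sum_subtractf sum.distrib tangents_def power2_eq_square sum.delta' algebra_simps del: sum_of_bool_eq)
  finally show ?thesis .
qed

text \<open>Averaging over incidences rather than points: the double sum equals the sum of n_P over
  all members \<open>g\<close> and all points P on \<open>g\<close>, which has
  \<open>card U * q\<close> terms.\<close>

lemma exists_rich_point:
  fixes U :: "('a::{finite,field} \<times> 'a \<times> 'a) set"
  assumes "U \<noteq> {}"
  obtains x y where "(\<Sum>f\<in>U. \<Sum>g\<in>U. real (meets f g)) \<le>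
    real (card U) * (real CARD('a) * real (card {f \<in> U. ev f x = y}))"
proof -
  have "\<exists>x y. (\<Sum>f\<in>U. \<Sum>g\<in>U. real (meets f g)) \<le> real (card U) * (real CARD('a) * cnt U x y)"
  proof (rule ccontr)
    assume "\<not> ?thesis"
    then have *: "real (card U) * (real CARD('a) * cnt U x y) < (\<Sum>f\<in>U. \<Sum>g\<in>U. real (meets f g))" for x y
      by (auto simp: not_le)
    have "(\<Sum>g\<in>U. \<Sum>x\<in>(UNIV::'a set). real (card U) * (real CARD('a) * cnt U x (ev g x))) <
        (\<Sum>g\<in>U. \<Sum>x\<in>(UNIV::'a set). \<Sum>f\<in>U. \<Sum>g\<in>U. real (meets f g))"
      by (intro sum_strict_mono *) (use assms in auto)
    also have "\<dots> = real (card U) * (real CARD('a) * (\<Sum>f\<in>U. \<Sum>g\<in>U. real (meets f g)))" by simp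
    also have "(\<Sum>g\<in>U. \<Sum>x\<in>UNIV. real (card U) * (real CARD('a) * cnt U x (ev g x))) =
        real (card U) * (real CARD('a) * (\<Sum>g\<in>U. \<Sum>x\<in>UNIV. cnt U x (ev g x)))"
      by (simp add: sum_distrib_left)
    also have "(\<Sum>g\<in>U. \<Sum>x\<in>UNIV. cnt U x (ev g x)) = (\<Sum>f\<in>U. \<Sum>g\<in>U. real (meets f g))"
      unfolding sum_cnt_ev by (subst sum.swap) (simp add: meets_def)
    finally show False by simp
  qed
  then show thesis using that by (auto simp: cnt_eq_card)
qed

section \<open>Upper bounds for tangent pairs\<close>

lemma tangents_mono_right: "B \<subseteq> U \<Longrightarrow> tangents A B \<le> tangents A U"
  unfolding tangents_def by (intro sum_mono sum_mono2) auto

lemma tangents_Un: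
  assumes "A \<subseteq> U"
  shows "tangents A U = tangents A A + tangents A (U - A)"
  unfolding tangents_def sum.distrib[symmetric]
  by (rule sum.cong[OF refl], subst sum.subset_diff[OF assms]) auto

text \<open>A tangent pair shares its first or its second coefficient, and each member has at most
  \<open>q - 1\<close> partners of either kind.\<close>

lemma tangents_char_2_le:
  fixes U :: "('a::{finite,field} \<times> 'a \<times> 'a) set"
  assumes two: "(2::'a) = 0" and U: "\<forall>f\<in>U. \<forall>g\<in>U. meets f g > 0" and AU: "A \<subseteq> U"
  shows "tangents A U \<le> card A * (2 * (real CARD('a) - 1))"
proof -
  have q: "CARD('a) \<ge> 2" using card_mono[of UNIV "{0, 1 :: 'a}"] by simp
  have 1: "of_bool (meets f g = 1) \<le> of_bool (fst f = fst g) + of_bool (fst (snd f) = fst (snd g))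
      - (if f = g then 2 else (0::real))" for f g :: "'a \<times> 'a \<times> 'a"
  proof (cases "f = g \<or> fst f = fst g")
    case True
    then show ?thesis using q by auto
  next
    case False
    have "fst (snd f) = fst (snd g)" if "meets f g = 1"
    proof -
      obtain a b c a' b' c' where fg: "f = (a, b, c)" "g = (a', b', c')" by (metis prod_cases3)
      then have "meets (a, b, c) (a', b', c') = 1" "a \<noteq> a'" using that False by auto
      then obtain r where "b - b' = (a - a') * (- 2 * r)" by (rule tangent_cases)
      then show ?thesis using two fg by simp
    qed
    then show ?thesis using False by auto
  qed
  have "tangents A U \<le> (\<Sum>f\<in>A. \<Sum>g\<in>U. of_bool (fst f = fst g) + of_bool (fst (snd f) = fst (snd g))
      - (if f = g then 2 else (0::real)))"
    unfolding tangents_def by (intro sum_mono 1)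
  also have "\<dots> \<le> (\<Sum>f\<in>A. 2 * (real CARD('a) - 1))"
  proof (rule sum_mono)
    fix f assume "f \<in> A"
    then have "f \<in> U" using AU by auto
    then show "(\<Sum>g\<in>U. of_bool (fst f = fst g) + of_bool (fst (snd f) = fst (snd g))
      - (if f = g then 2 else (0::real))) \<le> 2 * (real CARD('a) - 1)"
      using card_same_coeff_le[OF U, of f]
      by (simp add: sum_subtractf sum.distrib sum.delta' del: sum_of_bool_eq)
  qed
  finally show ?thesis by simp
qed

lemma tangents_le_parallel:
  fixes U :: "('a::{finite,field} \<times> 'a \<times> 'a) set"
  assumes U: "\<forall>f\<in>U. \<forall>g\<in>U. meets f g > 0" and AU: "A \<subseteq> U"
  shows "tangents A U \<le> card A * (real CARD('a) - 1) +
    ((\<Sum>r\<in>UNIV. \<Sum>f\<in>A. \<Sum>g\<in>U. of_bool (parallel r (f - g))) - CARD('a) * real (card A))"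
proof -
  have q: "CARD('a) \<ge> 2" using card_mono[of UNIV "{0, 1 :: 'a}"] by simp
  \<comment> \<open>A diagonal pair is parallel for all \<open>q\<close> values of \<open>r\<close>
    and shares its leading coefficient, hence the correction \<open>q + 1\<close>.\<close>
  have 1: "of_bool (meets f g = 1) \<le> of_bool (fst f = fst g) + (\<Sum>r\<in>UNIV. of_bool (parallel r (f - g)))
      - (if f = g then real CARD('a) + 1 else (0::real))" for f g :: "'a \<times> 'a \<times> 'a"
  proof -
    consider "f = g" | "f \<noteq> g" "fst f = fst g \<or> meets f g \<noteq> 1" | "fst f \<noteq> fst g" "meets f g = 1" by auto
    then show ?thesis
    proof cases
      case 1
      then show ?thesis using q by (simp add: zero_prod_def)
    next
      case 2
      have "(\<Sum>r\<in>UNIV. of_bool (parallel r (f - g))) \<ge> (0::real)" by (intro sum_nonneg) auto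
      then show ?thesis using 2 by (auto simp: of_bool_def simp del: sum_of_bool_eq)
    next
      case 3
      obtain a b c a' b' c' where fg: "f = (a, b, c)" "g = (a', b', c')" by (metis prod_cases3)
      then obtain r where "b - b' = (a - a') * (- 2 * r)" "c - c' = (a - a') * r\<^sup>2"
        using tangent_cases[of a b c a' b' c'] 3 by auto
      then have "parallel r (f - g)" by (simp add: fg mult_ac)
      then have "card {r. parallel r (f - g)} > 0" by (auto simp: card_gt_0_iff)
      then show ?thesis using 3 by auto
    qed
  qed
  have "tangents A U \<le> (\<Sum>f\<in>A. \<Sum>g\<in>U. of_bool (fst f = fst g) + (\<Sum>r\<in>UNIV. of_bool (parallel r (f - g)))
      - (if f = g then real CARD('a) + 1 else (0::real)))"
    unfolding tangents_def by (intro sum_mono 1)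
  also have "\<dots> \<le> (\<Sum>f\<in>A. (\<Sum>g\<in>U. \<Sum>r\<in>UNIV. of_bool (parallel r (f - g))) - 1)"
  proof (rule sum_mono)
    fix f assume "f \<in> A"
    then have "f \<in> U" using AU by auto
    then show "(\<Sum>g\<in>U. of_bool (fst f = fst g) + (\<Sum>r\<in>UNIV. of_bool (parallel r (f - g)))
      - (if f = g then real CARD('a) + 1 else (0::real))) \<le> (\<Sum>g\<in>U. \<Sum>r\<in>UNIV. of_bool (parallel r (f - g))) - 1"
      using card_same_coeff_le(1)[OF U, of f]
      by (simp add: sum_subtractf sum.distrib sum.delta' del: sum_of_bool_eq)
  qed
  also have "\<dots> = (\<Sum>f\<in>A. \<Sum>g\<in>U. \<Sum>r\<in>UNIV. of_bool (parallel r (f - g))) - real (card A)"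
    by (simp add: sum_subtractf del: sum_of_bool_eq)
  also have "(\<Sum>f\<in>A. \<Sum>g\<in>U. \<Sum>r\<in>UNIV. of_bool (parallel r (f - g))) =
      (\<Sum>r\<in>UNIV. \<Sum>f\<in>A. \<Sum>g\<in>U. of_bool (parallel r (f - g)) :: real)"
    by (subst (2) sum.swap, rule sum.cong[OF refl], rule sum.swap)
  finally show ?thesis by (simp add: algebra_simps del: sum_of_bool_eq)
qed

text \<open>\<open>S\<close> is bounded below in terms of \<open>D\<close>, which is itself
  decreasing in \<open>S\<close>. Eliminating \<open>D\<close> gives the first bound; substituting
  back gives the second.\<close>

lemma rich_point_bounds_odd:
  fixes q u v S D :: real
  assumes q: "q \<ge> 11" and u: "24/25 * q\<^sup>2 \<le> u" "u \<le> q\<^sup>2" and v: "u = q * v"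
    and S: "S \<ge> 2 * u\<^sup>2 - u - (u * v - v\<^sup>2) - D / q" and D: "D = q\<^sup>2 * u + u\<^sup>2 - u * v - S"
  shows "182/100 * q * (u * q) \<le> S" and "D \<le> 427/10000 * q ^ 4"
proof -
  have v96: "v \<ge> 24/25 * q" using u(1) q unfolding v power2_eq_square by simp
  have "q\<^sup>2 > 0" using q by simp
  then have u0: "u > 0" using u(1) by linarith
  have "q * (2 * u\<^sup>2 - u - (u * v - v\<^sup>2) - D / q) \<le> q * S"
    using S q by (intro mult_left_mono) auto
  then have "2 * q * u\<^sup>2 - q * u - u * u + u * v - D \<le> q * S"
    using q by (simp add: v power2_eq_square algebra_simps)
  then have S': "u * (2 * u * (q - 1) - q - q\<^sup>2 + 2 * v) \<le> (q - 1) * S"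
    unfolding D by (simp add: power2_eq_square algebra_simps)
  have sq: "11 * q \<le> q\<^sup>2" using q by (simp add: power2_eq_square)
  have "2 * u * (q - 1) \<ge> 2 * (24/25 * q\<^sup>2) * (q - 1)"
    using u(1) q by (intro mult_right_mono) auto
  moreover have "2 * (24/25 * q\<^sup>2) * (q - 1) - 182/100 * q\<^sup>2 * (q - 1) = 1/10 * (q * (q\<^sup>2 - q))"
    by (simp add: power2_eq_square field_simps)
  moreover have "q * (1/10 * q\<^sup>2 - 11/10 * q + 23/25) \<ge> 0"
    using q sq by (intro mult_nonneg_nonneg) linarith+
  then have "1/10 * (q * (q\<^sup>2 - q)) - q\<^sup>2 - q + 48/25 * q \<ge> 0"
    by (simp add: power2_eq_square field_simps)
  ultimately have "182/100 * q\<^sup>2 * (q - 1) \<le> 2 * u * (q - 1) - q - q\<^sup>2 + 2 * v"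
    using v96 by linarith
  then have "u * (182/100 * q\<^sup>2 * (q - 1)) \<le> (q - 1) * S"
    using S' u0 by (smt (verit) mult_left_mono)
  then have "(q - 1) * (182/100 * q * (u * q)) \<le> (q - 1) * S"
    by (simp add: power2_eq_square mult_ac)
  then show "182/100 * q * (u * q) \<le> S" using q by simp
  have "(q - 1) * D = (q - 1) * (q\<^sup>2 * u + u\<^sup>2 - u * v) - (q - 1) * S"
    unfolding D by (simp add: algebra_simps)
  also have "\<dots> \<le> (q - 1) * (q\<^sup>2 * u + u\<^sup>2 - u * v) - u * (2 * u * (q - 1) - q - q\<^sup>2 + 2 * v)"
    using S' by simp
  also have "\<dots> = u * (q * (q\<^sup>2 - u) + (q - v))"
    by (simp add: v power2_eq_square algebra_simps)
  finally have "q * ((q - 1) * D) \<le> q * (u * (q * (q\<^sup>2 - u) + (q - v)))"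
    using q by simp
  also have "\<dots> = u * (q\<^sup>2 - u) * (q\<^sup>2 + 1)"
    by (simp add: v power2_eq_square algebra_simps)
  also have "\<dots> \<le> (24/25 * q\<^sup>2) * (1/25 * q\<^sup>2) * (q\<^sup>2 + 1)"
  proof (rule mult_right_mono)
    \<comment> \<open>Beyond \<open>q\<^sup>2 / 2\<close> the product
      \<open>u * (q\<^sup>2 - u)\<close> decreases, so its maximum is at the smallest admissible
      \<open>u\<close>.\<close>
    have "(u - 24/25 * q\<^sup>2) * (u - 1/25 * q\<^sup>2) \<ge> 0"
      using u(1) q by (intro mult_nonneg_nonneg) (auto intro: order_trans[rotated])
    then show "u * (q\<^sup>2 - u) \<le> (24/25 * q\<^sup>2) * (1/25 * q\<^sup>2)"
      by (simp add: field_simps power2_eq_square)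
  qed simp
  also have "\<dots> = q ^ 4 * (24/625 * (q\<^sup>2 + 1))"
    by (simp add: power2_eq_square power4_eq_xxxx)
  also have "\<dots> \<le> q ^ 4 * (427/10000 * (q\<^sup>2 - q))"
    using q sq by (intro mult_left_mono) auto
  also have "\<dots> = q * (q - 1) * (427/10000 * q ^ 4)"
    by (simp add: power2_eq_square algebra_simps)
  finally have "q * (q - 1) * D \<le> q * (q - 1) * (427/10000 * q ^ 4)"
    by (simp add: mult.assoc)
  then show "D \<le> 427/10000 * q ^ 4" using q by simp
qed

lemma parallel_error_bound:
  fixes q n D N :: real
  assumes q: "q \<ge> 11" and n: "n \<ge> 182/100 * q" and D: "D \<le> 427/10000 * q ^ 4" and N: "N\<^sup>2 \<le> n * D"
  shows "N \<le> n * (47/1000 * q\<^sup>2)"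
proof (rule power2_le_imp_le)
  have n20: "n \<ge> 20" using n q by simp
  have "N\<^sup>2 \<le> n * (427/10000 * q ^ 4)"
    using N D n20 by (smt (verit) mult_left_mono)
  \<comment> \<open>\<open>2209/1000000\<close> is the square of \<open>47/1000\<close>, and 20
    times it exceeds \<open>427/10000\<close>.\<close>
  also have "\<dots> \<le> n * (n * (2209/1000000) * q ^ 4)"
    using n20 q by (intro mult_left_mono mult_right_mono) auto
  also have "\<dots> = (n * (47/1000 * q\<^sup>2))\<^sup>2"
    by (simp add: power2_eq_square power4_eq_xxxx)
  finally show "N\<^sup>2 \<le> (n * (47/1000 * q\<^sup>2))\<^sup>2" .
  show "0 \<le> n * (47/1000 * q\<^sup>2)" using n20 by simp
qed

text \<open>Without a common point some member avoids \<open>(x, y)\<close>, so the estimates for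
  outside polynomials apply; the third bound sums the double-meeting count over all of
  \<open>U - A\<close>.\<close>

lemma star_bounds_if_no_common_point:
  fixes U :: "('a::{finite,field} \<times> 'a \<times> 'a) set" and x y :: 'a and n T :: real
  assumes q: "CARD('a) \<ge> 3" and U: "\<forall>f\<in>U. \<forall>g\<in>U. meets f g > 0"
    and not: "\<not> (\<exists>x y. \<forall>f\<in>U. ev f x = y)"
  defines "A \<equiv> {f \<in> U. ev f x = y}"
  defines "n \<equiv> real (card A)" and "T \<equiv> tangents A (U - A)"
  shows "n \<le> (real CARD('a) - 1) * (real CARD('a) + 2) / 2"
    and "((card U - n) * (n * (1 + 1 / CARD('a))) - T)\<^sup>2 \<le>
      (card U - n) * ((real CARD('a) - 1) * (n * ((real CARD('a))\<^sup>2 - n)))"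
    and "(card U - n) * (n - (real CARD('a) - 1) * (real CARD('a) - 2) / 2) \<le> T"
proof -
  let ?B = "U - A"
  obtain g where g: "g \<in> U" "ev g x \<noteq> y" using not by blast
  have A: "\<forall>f\<in>A. ev f x = y" and int: "\<forall>f\<in>A. \<forall>g\<in>?B. meets f g > 0"
    and B: "\<forall>g\<in>?B. ev g x \<noteq> y"
    using U by (auto simp: A_def)
  have cB: "real (card ?B) = card U - n"
    unfolding n_def by (subst card_Diff_subset) (auto simp: A_def of_nat_diff card_mono)
  show "n \<le> (real CARD('a) - 1) * (real CARD('a) + 2) / 2"
    unfolding n_def using star_meeting_outside(1)[OF q A g(2)] int g by (auto simp: A_def)
  show "((card U - n) * (n * (1 + 1 / CARD('a))) - T)\<^sup>2 \<le>
      (card U - n) * ((real CARD('a) - 1) * (n * ((real CARD('a))\<^sup>2 - n)))"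
    using star_outside_inequality[OF q A B int] unfolding cB T_def n_def by simp
  have "(\<Sum>g\<in>?B. n - (real CARD('a) - 1) * (real CARD('a) - 2) / 2) \<le>
      (\<Sum>g\<in>?B. \<Sum>f\<in>A. of_bool (meets f g = 1))"
  proof (rule sum_mono)
    fix g assume "g \<in> ?B"
    then show "n - (real CARD('a) - 1) * (real CARD('a) - 2) / 2 \<le> (\<Sum>f\<in>A. of_bool (meets f g = 1))"
      using star_meeting_outside(2)[OF q A, of g] int B unfolding n_def by fastforce
  qed
  also have "\<dots> = T" unfolding T_def tangents_def by (rule sum.swap)
  finally show "(card U - n) * (n - (real CARD('a) - 1) * (real CARD('a) - 2) / 2) \<le> T"
    using cB by simp
qed

section \<open>Existence of the common point for odd and even order\<close>

lemma common_point_odd: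
  fixes U :: "('a::{finite,field} \<times> 'a \<times> 'a) set"
  assumes q: "CARD('a) \<ge> 11" and two: "(2::'a) \<noteq> 0" and U: "\<forall>f\<in>U. \<forall>g\<in>U. meets f g > 0"
    and big: "24/25 * (real CARD('a))\<^sup>2 \<le> card U"
  shows "\<exists>x y. \<forall>f\<in>U. ev f x = y"
proof (rule ccontr)
  assume not: "\<not> ?thesis"
  define q where "q = real CARD('a)"
  define u where "u = real (card U)"
  define v where "v = u / q"
  define S where "S = (\<Sum>f\<in>U. \<Sum>g\<in>U. real (meets f g))"
  define D where "D = q\<^sup>2 * u + u\<^sup>2 - u\<^sup>2 / q - S"
  have q11: "q \<ge> 11" using q by (simp add: q_def)
  have q3: "CARD('a) \<ge> 3" using q by simp
  have ubounds: "24/25 * q\<^sup>2 \<le> u" "u \<le> q\<^sup>2"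
    using big card_pairwise_meeting_le[OF U] by (simp_all add: q_def u_def)
  have v: "u = q * v" using q11 by (simp add: v_def)
  have "q\<^sup>2 > 0" using q11 by simp
  then have u0: "u > 0" using ubounds(1) by linarith
  have "U \<noteq> {}" using u0 by (auto simp: u_def)
  have D': "D = q\<^sup>2 * u + u\<^sup>2 - u * v - S" unfolding D_def v_def by (simp add: power2_eq_square)
  define N where "N A = (\<Sum>r\<in>UNIV. \<Sum>f\<in>A. \<Sum>g\<in>U. of_bool (parallel r (f - g))) - q * real (card A)
      - real (card A) * u * (q - 1) / q\<^sup>2" for A
  have T: "tangents A U \<le> card A * (q - 1) + N A + card A * u * (q - 1) / q\<^sup>2" if "A \<subseteq> U" for A
    using tangents_le_parallel[OF U that] unfolding N_def q_def by simp
  \<comment> \<open>First use of the parallel pair bound, on all of \<open>U\<close>, to find the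
    rich point; the second use is on the star at that point.\<close>
  have "N U \<le> D / q"
    using parallel_pairs_bound(2)[OF two, of U U] unfolding N_def D_def S_def q_def u_def by simp
  moreover have "u * u * (q - 1) / q\<^sup>2 = u * v - v\<^sup>2"
    using q11 unfolding v by (simp add: power2_eq_square field_simps)
  ultimately have "tangents U U \<le> u * (q - 1) + D / q + (u * v - v\<^sup>2)"
    using T[of U] unfolding u_def by simp
  then have "S \<ge> 2 * u\<^sup>2 - u - (u * v - v\<^sup>2) - D / q"
    unfolding S_def sum_meets_pairwise_meeting[OF U] q_def[symmetric] u_def[symmetric]
    by (simp add: algebra_simps)
  note bounds = rich_point_bounds_odd[OF q11 ubounds v this D']
  obtain x y where "S \<le> u * (q * real (card {f \<in> U. ev f x = y}))"
    by (rule exists_rich_point[OF \<open>U \<noteq> {}\<close>, folded S_def u_def q_def])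
  define A where "A = {f \<in> U. ev f x = y}"
  define n where "n = real (card A)"
  have AU: "A \<subseteq> U" by (auto simp: A_def)
  have "182/100 * q * (u * q) \<le> n * (u * q)"
    using bounds(1) \<open>S \<le> _\<close> unfolding n_def A_def by (simp add: mult_ac)
  then have n: "n \<ge> 182/100 * q" using u0 q11 by simp
  have "(N A)\<^sup>2 \<le> n * D"
    using parallel_pairs_bound(1)[OF two AU] unfolding N_def D_def S_def q_def u_def n_def by simp
  then have NA: "N A \<le> n * (47/1000 * q\<^sup>2)"
    by (rule parallel_error_bound[OF q11 n bounds(2)])
  \<comment> \<open>Since \<open>u \<le> q\<^sup>2\<close>, the main term for parallel pairs costs
    no more than the pairs with equal leading coefficient.\<close>
  have "n * u * (q - 1) / q\<^sup>2 \<le> n * (q - 1)"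
  proof -
    have "u * (n * (q - 1)) \<le> q\<^sup>2 * (n * (q - 1))"
      using ubounds(2) q11 by (intro mult_right_mono) (auto simp: n_def)
    then show ?thesis using q11 by (simp add: divide_le_eq mult_ac)
  qed
  then have "tangents A U \<le> n * (2 * (q - 1) + 47/1000 * q\<^sup>2)"
    using T[OF AU] NA unfolding n_def by (simp add: algebra_simps)
  then have TB: "tangents A (U - A) \<le> n * (2 * (q - 1) + 47/1000 * q\<^sup>2)"
    using tangents_mono_right[of "U - A" U A] by fastforce
  note star = star_bounds_if_no_common_point[OF q3 U not, of x y, folded A_def n_def q_def u_def]
  show False
    by (rule no_large_star_odd[OF q11 ubounds(1) n star(1) TB star(2)])
qed

lemma common_point_even:
  fixes U :: "('a::{finite,field} \<times> 'a \<times> 'a) set"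
  assumes q: "CARD('a) > 2" and two: "(2::'a) = 0" and U: "\<forall>f\<in>U. \<forall>g\<in>U. meets f g > 0"
    and big: "CARD('a) \<ge> 8 \<Longrightarrow> 932/1000 * (real CARD('a))\<^sup>2 \<le> card U"
    and big4: "CARD('a) = 4 \<Longrightarrow> card U \<ge> 15"
  shows "\<exists>x y. \<forall>f\<in>U. ev f x = y"
proof (rule ccontr)
  assume not: "\<not> ?thesis"
  define q where "q = real CARD('a)"
  define u where "u = real (card U)"
  define S where "S = (\<Sum>f\<in>U. \<Sum>g\<in>U. real (meets f g))"
  have q3: "CARD('a) \<ge> 3" using q by simp
  have q0: "q > 2" using q by (simp add: q_def)
  have "even CARD('a)" using two two_eq_0_iff_even_card by blast
  then have "CARD('a) = 4 \<or> CARD('a) > 4" using q by presburger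
  then have cases: "CARD('a) = 4 \<or> CARD('a) \<ge> 8" using even_card_field_ge_8[OF two] by blast
  have "U \<noteq> {}" using not by auto
  then have u0: "u > 0" by (auto simp: u_def card_gt_0_iff)
  have T: "tangents A U \<le> card A * (2 * (q - 1))" if "A \<subseteq> U" for A
    using tangents_char_2_le[OF two U that] by (simp add: q_def)
  have S: "u * (2 * u - q) \<le> S"
    using T[of U] unfolding S_def sum_meets_pairwise_meeting[OF U] q_def[symmetric] u_def[symmetric]
    by (simp add: u_def power2_eq_square algebra_simps)
  obtain x y where xy: "S \<le> u * (q * real (card {f \<in> U. ev f x = y}))"
    by (rule exists_rich_point[OF \<open>U \<noteq> {}\<close>, folded S_def u_def q_def])
  define A where "A = {f \<in> U. ev f x = y}"
  define n where "n = real (card A)"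
  have "u * (2 * u - q) \<le> u * (q * n)"
    using S xy unfolding n_def A_def by linarith
  then have n: "2 * u - q \<le> q * n" using u0 by simp
  have AU: "A \<subseteq> U" by (auto simp: A_def)
  note star = star_bounds_if_no_common_point[OF q3 U not, of x y, folded A_def n_def q_def u_def]
  from cases show False
  proof
    assume q8: "CARD('a) \<ge> 8"
    then have q8': "q \<ge> 8" by (simp add: q_def)
    have ub: "932/1000 * q\<^sup>2 \<le> u" using big[OF q8] by (simp add: q_def u_def)
    have "q * (1864/1000 * q - 1) \<le> q * n"
      using n ub by (simp add: power2_eq_square algebra_simps)
    then have "n \<ge> 1864/1000 * q - 1" using q0 by simp
    \<comment> \<open>\<open>1739/1000 = 1864/1000 - 1/8\<close>, as
      \<open>1 \<le> q / 8\<close>.\<close>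
    then have n': "n \<ge> 1739/1000 * q" using q8' by linarith
    have TB: "tangents A (U - A) \<le> n * (2 * (q - 1))"
      using tangents_mono_right[of "U - A" U A] T[OF AU] unfolding n_def by fastforce
    show False by (rule no_large_star_even[OF q8' ub n' star(1) TB star(2)])
  next
    assume q4: "CARD('a) = 4"
    then have q4': "q = 4" by (simp add: q_def)
    have u15: "u \<ge> 15" using big4[OF q4] by (simp add: u_def)
    then have "n \<ge> 13/2" using n q4' by simp
    \<comment> \<open>Rounding up to an integer matters: the final quadratic is still negative at
      \<open>13/2\<close>.\<close>
    then have "card A \<ge> 7" unfolding n_def by linarith
    then have n7: "n \<ge> 7" by (simp add: n_def)
    have n9: "n \<le> 9" using star(1) q4' by simp
    have "tangents A A \<ge> 2 * n\<^sup>2 / q - 2 * n"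
      using star_tangents_ge[OF q3, of A x y] unfolding A_def n_def q_def by simp
    then have "tangents A (U - A) \<le> 8 * n - n\<^sup>2 / 2"
      using tangents_Un[OF AU] T[OF AU] q4' by (simp add: n_def)
    then have "(u - n) * (n - 3) \<le> 8 * n - n\<^sup>2 / 2" using star(3) q4' by simp
    moreover have "(15 - n) * (n - 3) \<le> (u - n) * (n - 3)"
      using u15 n7 by (intro mult_right_mono) auto
    ultimately have "10 * n - 1/2 * n\<^sup>2 - 45 \<le> 0"
      by (simp add: power2_eq_square algebra_simps)
    moreover have "10 * n - 1/2 * n\<^sup>2 - 45 > 0"
      by (rule concave_quadratic_pos[OF _ n7 n9]) auto
    ultimately show False by linarith
  qed
qed

section \<open>Transfer from polynomials to coefficient triples\<close>

lemma poly_degree_le_2: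
  fixes p :: "'a::field poly"
  assumes "degree p \<le> 2"
  shows "poly p x = ev (coeff p 2, coeff p 1, coeff p 0) x"
proof -
  have "poly p x = (\<Sum>i\<le>2. coeff p i * x ^ i)"
    unfolding poly_altdef using assms
    by (intro sum.mono_neutral_left) (auto simp: coeff_eq_0)
  then show ?thesis by (simp add: numeral_2_eq_2 algebra_simps)
qed

theorem theorem1:
  fixes U :: "'a::{finite, field} poly set"
  defines "q \<equiv> card (UNIV :: 'a set)"
  assumes q_bound: "(odd q \<and> q > 9) \<or> (even q \<and> q > 2)"
    and deg: "\<forall>g\<in>U. degree g \<le> 2"
    and inter: "intersecting U"
    and big: "real (card U) > real q ^ 2 - real q * sqrt (real q) / 4
                 + (if even q then 1 else 3) * real q / 8 + sqrt (real q) / 8"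
  shows "\<exists>\<alpha> \<beta>. \<forall>g\<in>U. poly g \<alpha> = \<beta>"
proof -
  define t where "t p = (coeff p 2, coeff p 1, coeff p 0)" for p :: "'a poly"
  have ev: "poly g x = ev (t g) x" if "g \<in> U" for g x
    unfolding t_def using deg that by (simp add: poly_degree_le_2)
  have "inj_on t U"
  proof (rule inj_onI)
    fix p p' assume p: "p \<in> U" "p' \<in> U" "t p = t p'"
    show "p = p'"
    proof (rule poly_eqI)
      fix i :: nat
      consider "i = 0" | "i = 1" | "i = 2" | "i > 2" by linarith
      then show "coeff p i = coeff p' i"
      proof cases
        case 4
        then have "degree p < i" "degree p' < i" using p deg by force+
        then show ?thesis by (simp add: coeff_eq_0)
      qed (use p in \<open>auto simp: t_def\<close>)
    qed
  qed
  then have card: "card (t ` U) = card U" by (rule card_image)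
  have meets: "\<forall>f\<in>t ` U. \<forall>g\<in>t ` U. meets f g > 0"
  proof (intro ballI)
    fix f' g' assume "f' \<in> t ` U" "g' \<in> t ` U"
    then obtain f g where fg: "f \<in> U" "g \<in> U" and t: "f' = t f" "g' = t g" by blast
    then have "graph_of f \<inter> graph_of g \<noteq> {}" using inter by (auto simp: intersecting_def)
    then obtain x where "poly f x = poly g x" by (auto simp: graph_of_def)
    then have "x \<in> {x. ev (t f) x = ev (t g) x}" using ev fg by simp
    then show "meets f' g' > 0" unfolding t meets_def card_gt_0_iff by auto
  qed
  have "\<exists>x y. \<forall>f\<in>t ` U. ev f x = y"
  proof (cases "even q")
    case True
    then have q2: "q > 2" and two: "(2::'a) = 0"
      using q_bound two_eq_0_iff_even_card[where 'a = 'a] by (auto simp: q_def)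
    have big': "real (card U) > (real q)\<^sup>2 - real q * sqrt (real q) / 4 + real q / 8 + sqrt (real q) / 8"
      using big True by simp
    show ?thesis
    proof (rule common_point_even[OF _ two meets])
      show "CARD('a) > 2" using q2 by (simp add: q_def)
      show "932/1000 * (real CARD('a))\<^sup>2 \<le> card (t ` U)" if "CARD('a) \<ge> 8"
        using threshold_even[of "real q"] that big' unfolding card q_def by simp
      show "card (t ` U) \<ge> 15" if "CARD('a) = 4"
      proof -
        \<comment> \<open>At order 4 the threshold is 14.75, so \<open>U\<close> has at least 15
          members.\<close>
        have "sqrt (real q) = 2" using that by (simp add: q_def real_sqrt_eq_iff real_sqrt_unique)
        then have "real (card U) > 14" using big' that by (simp add: q_def)
        then show ?thesis unfolding card by linarith
      qed
    qed
  next
    case False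
    then have q9: "q > 9" and two: "(2::'a) \<noteq> 0"
      using q_bound two_eq_0_iff_even_card[where 'a = 'a] by (auto simp: q_def)
    have "q \<noteq> 10" using False by auto
    then have q11: "q \<ge> 11" using q9 by linarith
    show ?thesis
    proof (rule common_point_odd[OF _ two meets])
      show "CARD('a) \<ge> 11" using q11 by (simp add: q_def)
      show "24/25 * (real CARD('a))\<^sup>2 \<le> card (t ` U)"
        using threshold_odd[of "real q"] q11 big False unfolding card q_def by simp
    qed
  qed
  then obtain x y where "\<forall>f\<in>t ` U. ev f x = y" by blast
  then have "\<forall>g\<in>U. poly g x = y" using ev by simp
  then show ?thesis by blast
qed

end
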